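(* Let $x:T^2\rightarrow S^2\times S^1$ be an immersed torus. Then $W(x)=\int_{T^2}(|\vec H|^2-K+\tilde K)\,dM\geq 0$. Moreover, $W(x)=0$ if and only if $x(T^2)$ is a totally geodesic torus in $S^2\times S^1$; in that case $x(T^2)$ is congruent, under an isometry of $S^2\times S^1$, to the Clifford torus parametrized by $(u,v)\mapsto(\cos u,\sin u,0,\cos v,\sin v)\in S^2\times S^1$.
   Context: $S^2\subset\mathbb{R}^3$ is the unit sphere (constant curvature $1$), $S^1\subset\mathbb{R}^2$ is the unit circle, and $S^2\times S^1\subset\mathbb{R}^3\times\mathbb{R}^2$ carries the product Riemannian metric. $T^2$ denotes the 2-dimensional torus (as a smooth closed surface). For an immersed surface $x:M\to N$ in a Riemannian manifold, with the induced metric on $M$, $II$ is the second fundamental form, $\vec H=\frac12\,\mathrm{tr}\,II$ is the mean curvature vector, $K$ is the Gauss curvature of the induced metric, $\tilde K$ is the sectional curvature of $N$ on the tangent plane of the immersed surface, and $dM$ is the induced area element. The Willmore functional is $W(x)=\int_M(|\vec H|^2-K+\tilde K)\,dM$. The surface is totally geodesic if $II\equiv0$. *)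

theory Defs
  imports "HOL-Analysis.Analysis"
begin

section \<open>Smooth maps\<close>

definition dir_deriv ::
    "'a::real_normed_vector \<Rightarrow> ('a \<Rightarrow> 'b::real_normed_vector) \<Rightarrow> 'a \<Rightarrow> 'b" where
  "dir_deriv v f = (\<lambda>y. frechet_derivative f (at y) v)"

abbreviation partial_deriv ::
    "'n::finite \<Rightarrow> (real ^ 'n \<Rightarrow> 'b::real_normed_vector) \<Rightarrow> real ^ 'n \<Rightarrow> 'b" where
  "partial_deriv i \<equiv> dir_deriv (axis i 1)"

text \<open>
  C-infinity on an open set: all iterated directional derivatives are (Frechet) differentiable
  and hence continuous.
\<close>

definition smooth_on ::
    "'a::euclidean_space set \<Rightarrow> ('a \<Rightarrow> 'b::real_normed_vector) \<Rightarrow> bool" where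
  "smooth_on U f \<longleftrightarrow> open U \<and> (\<forall>vs. foldr dir_deriv vs f differentiable_on U)"

definition orth_proj :: "'a::euclidean_space set \<Rightarrow> 'a \<Rightarrow> 'a" where
  "orth_proj V a = (THE b. b \<in> V \<and> a - b \<in> V\<^sup>\<bottom>)"


section \<open>The Riemannian manifold \<open>S\<^sup>2 \<times> S\<^sup>1\<close>\<close>

type_synonym ambient = "(real ^ 3) \<times> (real ^ 2)"

text \<open>
  The product metric on \<open>S2xS1\<close> is the restriction of the inner product of \<open>ambient\<close> to the
  tangent spaces.
\<close>

definition S2xS1 :: "ambient set" where
  "S2xS1 = sphere 0 1 \<times> sphere 0 1"

text \<open>
  For \<open>y \<in> S2xS1\<close> this is the tangent space of \<open>S2xS1\<close> at \<open>y\<close>. For other points with nonzero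
  components it is the tangent space of the product of the concentric spheres through \<open>y\<close>, so that
  \<open>y \<mapsto> orth_proj (tangent_space y) a\<close> is smooth near \<open>S2xS1\<close>.
\<close>

definition tangent_space :: "ambient \<Rightarrow> ambient set" where
  "tangent_space y = {v. fst v \<bullet> fst y = 0 \<and> snd v \<bullet> snd y = 0}"

text \<open>
  The Levi-Civita connection of a submanifold of Euclidean space is the tangential part of the
  ordinary derivative. Vector fields are given on a neighbourhood of \<open>S2xS1\<close>; for tangential
  fields the values on \<open>S2xS1\<close> of the operators below depend only on the values of the
  fields on \<open>S2xS1\<close>.
\<close>

definition levi_civita :: "(ambient \<Rightarrow> ambient) \<Rightarrow> (ambient \<Rightarrow> ambient) \<Rightarrow> ambient \<Rightarrow> ambient" where
  "levi_civita A B y = orth_proj (tangent_space y) (frechet_derivative B (at y) (A y))"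

definition lie_bracket :: "(ambient \<Rightarrow> ambient) \<Rightarrow> (ambient \<Rightarrow> ambient) \<Rightarrow> ambient \<Rightarrow> ambient" where
  "lie_bracket A B y = frechet_derivative B (at y) (A y) - frechet_derivative A (at y) (B y)"

definition curvature_op ::
    "(ambient \<Rightarrow> ambient) \<Rightarrow> (ambient \<Rightarrow> ambient) \<Rightarrow> (ambient \<Rightarrow> ambient) \<Rightarrow> ambient \<Rightarrow> ambient" where
  "curvature_op A B C y =
     levi_civita A (levi_civita B C) y - levi_civita B (levi_civita A C) y
     - levi_civita (lie_bracket A B) C y"

text \<open>
  Sectional curvature \<open>\<langle>R(a,b)b, a\<rangle> / (|a|\<^sup>2 |b|\<^sup>2 - \<langle>a,b\<rangle>\<^sup>2)\<close> of \<open>S2xS1\<close> at \<open>y\<close> on the plane spanned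
  by tangent vectors \<open>a\<close>, \<open>b\<close>. Since the curvature is tensorial, any tangential extensions
  of \<open>a\<close>, \<open>b\<close> to vector fields may be used; we take the projections of the constant fields.
\<close>

definition sectional_curvature :: "ambient \<Rightarrow> ambient \<Rightarrow> ambient \<Rightarrow> real" where
  "sectional_curvature y a b =
     (let A = (\<lambda>z. orth_proj (tangent_space z) a);
          B = (\<lambda>z. orth_proj (tangent_space z) b)
      in (curvature_op A B B y \<bullet> a) / ((a \<bullet> a) * (b \<bullet> b) - (a \<bullet> b)\<^sup>2))"

text \<open>
  Smooth bijection of \<open>S2xS1\<close> (smooth as the restriction of a map smooth on a neighbourhood)
  whose differential preserves the metric; the inverse is then automatically smooth.
\<close>

definition isometry_S2xS1 :: "(ambient \<Rightarrow> ambient) \<Rightarrow> bool" where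
  "isometry_S2xS1 \<phi> \<longleftrightarrow>
     (\<exists>U. S2xS1 \<subseteq> U \<and> smooth_on U \<phi>) \<and> bij_betw \<phi> S2xS1 S2xS1 \<and>
     (\<forall>y \<in> S2xS1. \<forall>v \<in> tangent_space y. \<forall>w \<in> tangent_space y.
        frechet_derivative \<phi> (at y) v \<bullet> frechet_derivative \<phi> (at y) w = v \<bullet> w)"


section \<open>Parametrized surfaces in \<open>S\<^sup>2 \<times> S\<^sup>1\<close>\<close>

definition tangent_plane :: "(real ^ 2 \<Rightarrow> ambient) \<Rightarrow> real ^ 2 \<Rightarrow> ambient set" where
  "tangent_plane X w = range (frechet_derivative X (at w))"

definition induced_metric :: "(real ^ 2 \<Rightarrow> ambient) \<Rightarrow> real ^ 2 \<Rightarrow> real ^ 2 ^ 2" where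
  "induced_metric X w = (\<chi> i j. partial_deriv i X w \<bullet> partial_deriv j X w)"

text \<open>
  \<open>II(\<partial>\<^sub>i, \<partial>\<^sub>j)\<close>: the covariant derivative in \<open>S2xS1\<close> of the coordinate field \<open>\<partial>\<^sub>j X\<close> in direction
  \<open>\<partial>\<^sub>i\<close>, projected to the orthogonal complement of the tangent plane of the surface.
\<close>

definition second_fund_form :: "(real ^ 2 \<Rightarrow> ambient) \<Rightarrow> 2 \<Rightarrow> 2 \<Rightarrow> real ^ 2 \<Rightarrow> ambient" where
  "second_fund_form X i j w =
     orth_proj ((tangent_plane X w)\<^sup>\<bottom>)
       (orth_proj (tangent_space (X w)) (partial_deriv i (partial_deriv j X) w))"

definition mean_curvature_vector :: "(real ^ 2 \<Rightarrow> ambient) \<Rightarrow> real ^ 2 \<Rightarrow> ambient" where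
  "mean_curvature_vector X w =
     (1/2) *\<^sub>R (\<Sum>i\<in>UNIV. \<Sum>j\<in>UNIV.
        matrix_inv (induced_metric X w) $ i $ j *\<^sub>R second_fund_form X i j w)"

definition christoffel :: "(real ^ 2 \<Rightarrow> real ^ 2 ^ 2) \<Rightarrow> 2 \<Rightarrow> 2 \<Rightarrow> 2 \<Rightarrow> real ^ 2 \<Rightarrow> real" where
  "christoffel g k i j w =
     (1/2) * (\<Sum>l\<in>UNIV. matrix_inv (g w) $ k $ l *
       (partial_deriv i (\<lambda>z. g z $ j $ l) w + partial_deriv j (\<lambda>z. g z $ i $ l) w
        - partial_deriv l (\<lambda>z. g z $ i $ j) w))"

text \<open>Component \<open>l\<close> of \<open>R(\<partial>\<^sub>i, \<partial>\<^sub>j) \<partial>\<^sub>k\<close>.\<close>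

definition riemann :: "(real ^ 2 \<Rightarrow> real ^ 2 ^ 2) \<Rightarrow> 2 \<Rightarrow> 2 \<Rightarrow> 2 \<Rightarrow> 2 \<Rightarrow> real ^ 2 \<Rightarrow> real" where
  "riemann g l k i j w =
     partial_deriv i (christoffel g l j k) w - partial_deriv j (christoffel g l i k) w
     + (\<Sum>m\<in>UNIV. christoffel g m j k w * christoffel g l i m w
                  - christoffel g m i k w * christoffel g l j m w)"

definition gauss_curvature :: "(real ^ 2 \<Rightarrow> real ^ 2 ^ 2) \<Rightarrow> real ^ 2 \<Rightarrow> real" where
  "gauss_curvature g w = (\<Sum>l\<in>UNIV. g w $ l $ 1 * riemann g l 2 1 2 w) / det (g w)"

definition ambient_curvature :: "(real ^ 2 \<Rightarrow> ambient) \<Rightarrow> real ^ 2 \<Rightarrow> real" where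
  "ambient_curvature X w = sectional_curvature (X w) (partial_deriv 1 X w) (partial_deriv 2 X w)"


section \<open>Immersed tori\<close>

definition T2 :: "((real ^ 2) \<times> (real ^ 2)) set" where
  "T2 = sphere 0 1 \<times> sphere 0 1"

text \<open>
  The universal covering of \<open>T2\<close>, a local diffeomorphism: its local inverses are charts of the
  smooth structure of \<open>T2\<close>, and the square \<open>[0, 2\<pi>]\<^sup>2\<close> is a fundamental domain. Hence a map on \<open>T2\<close> is a
  smooth immersion iff its composition with \<open>torus_cover\<close> is one, and all local quantities
  of the surface are computed in the coordinates \<open>w\<close>.
\<close>

definition torus_cover :: "real ^ 2 \<Rightarrow> (real ^ 2) \<times> (real ^ 2)" where
  "torus_cover w = (vector [cos (w $ 1), sin (w $ 1)], vector [cos (w $ 2), sin (w $ 2)])"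

definition immersed_torus :: "((real ^ 2) \<times> (real ^ 2) \<Rightarrow> ambient) \<Rightarrow> bool" where
  "immersed_torus x \<longleftrightarrow>
     x ` T2 \<subseteq> S2xS1 \<and> smooth_on UNIV (x \<circ> torus_cover) \<and>
     (\<forall>w. inj (frechet_derivative (x \<circ> torus_cover) (at w)))"

definition totally_geodesic :: "((real ^ 2) \<times> (real ^ 2) \<Rightarrow> ambient) \<Rightarrow> bool" where
  "totally_geodesic x \<longleftrightarrow> (\<forall>w i j. second_fund_form (x \<circ> torus_cover) i j w = 0)"

definition willmore :: "((real ^ 2) \<times> (real ^ 2) \<Rightarrow> ambient) \<Rightarrow> real" where
  "willmore x =
     (let X = x \<circ> torus_cover; g = induced_metric X
      in integral (cbox 0 (\<chi> i. 2 * pi))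
           (\<lambda>w. ((norm (mean_curvature_vector X w))\<^sup>2 - gauss_curvature g w + ambient_curvature X w)
                * sqrt (det (g w))))"

definition clifford_torus :: "ambient set" where
  "clifford_torus = {(vector [cos u, sin u, 0], vector [cos v, sin v]) | u v :: real. True}"

end

theory Submission
  imports Defs
begin

text \<open>
  Let \<open>X = (p, q)\<close> be the lift of the torus to the plane, with induced metric \<open>g\<close> and second fundamental form
  \<open>II\<close>. The Gauss equation \<open>K = K' + (II\<^sub>1\<^sub>1 \<bullet> II\<^sub>2\<^sub>2 - |II\<^sub>1\<^sub>2|\<^sup>2) / det g\<close>, where \<open>K'\<close> is the curvature of the
  ambient space on the tangent plane (\<open>gauss_equation\<close>), turns the Willmore density \<open>|H|\<^sup>2 - K + K'\<close> into
  \<open>|H|\<^sup>2\<close> minus the determinant of the second fundamental form relative to \<open>g\<close>. This is a sum of squares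
  that vanishes exactly where \<open>II\<close> is a multiple \<open>g h\<close> of the metric (\<open>willmore_density_eq\<close>, \<open>umbilic\<close>).
  So the Willmore functional is nonnegative, and it is zero exactly for the umbilic tori.

  An umbilic torus is totally geodesic. At an umbilic point the Gauss equation reads \<open>K = K' + |h|\<^sup>2\<close>, and
  \<open>K' \<ge> 0\<close> because \<open>S2xS1\<close> has nonnegative sectional curvature (\<open>sectional_curvature_S2xS1\<close>). By the theorem
  of Gauss and Bonnet the total curvature of a torus is zero, hence \<open>K = 0\<close> everywhere, and therefore
  \<open>h = 0\<close> and \<open>K' = 0\<close> (\<open>umbilic_torus\<close>). Gauss-Bonnet is elementary here: on a torus the
  coordinate frame is defined globally, and \<open>- K dA\<close> is the exterior derivative of the periodic connection
  form of the orthonormal frame obtained from it (\<open>curl_connection_form\<close>, \<open>gauss_bonnet_nonneg\<close>).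

  For a totally geodesic torus the same argument gives \<open>K' = 0\<close>, which says that the differentials of \<open>p\<close> and \<open>q\<close>
  both have rank one. A vector \<open>b\<close> that is orthogonal to \<open>p\<close> and to its derivatives at one point stays so, since
  \<open>II = 0\<close> is a linear system of differential equations for the inner products with \<open>b\<close>
  (\<open>totally_geodesic_in_great_circle\<close>). So the torus lies in the product of the great circle orthogonal to
  \<open>b\<close> with \<open>S\<^sup>1\<close>, and a second-derivative test at the point where the inner product with a given point is
  largest shows that it covers this product (\<open>totally_geodesic_range\<close>). A rotation of \<open>\<real>\<^sup>3\<close> that
  moves \<open>b\<close> to the third axis carries the product to the Clifford torus.
\<close>

section \<open>Directional derivatives\<close>

lemma dir_deriv_eqI: "(f has_derivative f') (at w) \<Longrightarrow> dir_deriv v f w = f' v"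
  by (metis dir_deriv_def frechet_derivative_at)

lemma has_derivative_dir_deriv:
  "f differentiable at w \<Longrightarrow> (f has_derivative (\<lambda>v. dir_deriv v f w)) (at w)"
  by (simp add: dir_deriv_def frechet_derivative_works)

lemma dir_deriv_add:
  assumes "f differentiable at w" "g differentiable at w"
  shows "dir_deriv v (\<lambda>z. f z + g z) w = dir_deriv v f w + dir_deriv v g w"
  by (rule dir_deriv_eqI[OF has_derivative_add[OF assms[THEN has_derivative_dir_deriv]]])

lemma dir_deriv_mult_real:
  fixes f g :: "'a::real_normed_vector \<Rightarrow> real"
  assumes "f differentiable at w" "g differentiable at w"
  shows "dir_deriv v (\<lambda>z. f z * g z) w = f w * dir_deriv v g w + dir_deriv v f w * g w"
  by (rule dir_deriv_eqI[OF has_derivative_mult[OF assms[THEN has_derivative_dir_deriv]]])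

lemma dir_deriv_inner:
  fixes f g :: "'a::real_normed_vector \<Rightarrow> 'b::real_inner"
  assumes "f differentiable at w" "g differentiable at w"
  shows "dir_deriv v (\<lambda>z. f z \<bullet> g z) w = f w \<bullet> dir_deriv v g w + dir_deriv v f w \<bullet> g w"
  by (rule dir_deriv_eqI[OF has_derivative_inner[OF assms[THEN has_derivative_dir_deriv]]])

lemma dir_deriv_const: "dir_deriv v (\<lambda>z. c) w = 0"
  using dir_deriv_eqI[OF has_derivative_const] .

lemma dir_deriv_bounded_linear:
  assumes "bounded_linear h" "f differentiable at w"
  shows "dir_deriv v (\<lambda>z. h (f z)) w = h (dir_deriv v f w)"
  by (rule dir_deriv_eqI[OF bounded_linear.has_derivative
        [OF assms(1) has_derivative_dir_deriv[OF assms(2)]]])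

lemma dir_deriv_expand:
  fixes f :: "real ^ 2 \<Rightarrow> 'b::real_normed_vector"
  assumes "f differentiable at w"
  shows "dir_deriv h f w = h $ 1 *\<^sub>R partial_deriv 1 f w + h $ 2 *\<^sub>R partial_deriv 2 f w"
proof -
  have lin: "linear (frechet_derivative f (at w))"
    by (rule linear_frechet_derivative[OF assms])
  have "h = h $ 1 *\<^sub>R axis 1 1 + h $ 2 *\<^sub>R axis 2 1"
    by (simp add: vec_eq_iff forall_2 axis_def)
  then have "frechet_derivative f (at w) h
      = frechet_derivative f (at w) (h $ 1 *\<^sub>R axis 1 1 + h $ 2 *\<^sub>R axis 2 1)"
    by simp
  then show ?thesis
    by (simp add: dir_deriv_def linear_add[OF lin] linear_scale[OF lin])
qed

text \<open>
  Iterated directional derivatives of a linear map are the map itself or constant.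
\<close>

lemma smooth_on_bounded_linear:
  fixes h :: "'a::euclidean_space \<Rightarrow> 'b::real_normed_vector"
  assumes "bounded_linear h"
  shows "smooth_on UNIV h"
proof -
  have dh: "dir_deriv v h = (\<lambda>_. h v)" for v
    by (rule ext) (rule dir_deriv_eqI[OF bounded_linear_imp_has_derivative[OF assms]])
  have dc: "dir_deriv v (\<lambda>_. c) = (\<lambda>_. 0)" for v :: 'a and c :: 'b
    by (rule ext) (rule dir_deriv_eqI[OF has_derivative_const])
  have "foldr dir_deriv vs h = h \<or> (\<exists>c. foldr dir_deriv vs h = (\<lambda>_. c))" for vs
    by (induction vs) (auto simp: dh dc)
  then have "foldr dir_deriv vs h differentiable_on UNIV" for vs
    using bounded_linear_imp_differentiable_on[OF assms] differentiable_on_const by metis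
  then show ?thesis by (simp add: smooth_on_def)
qed

lemma has_vector_derivative_along_line:
  assumes "f differentiable at (a + t *\<^sub>R v)"
  shows "((\<lambda>t. f (a + t *\<^sub>R v)) has_vector_derivative dir_deriv v f (a + t *\<^sub>R v)) (at t)"
proof -
  have "((\<lambda>t. a + t *\<^sub>R v) has_derivative (\<lambda>h. h *\<^sub>R v)) (at t)"
    by (auto intro!: derivative_eq_intros)
  from diff_chain_at[OF this has_derivative_dir_deriv[OF assms]]
  have "((\<lambda>t. f (a + t *\<^sub>R v)) has_derivative (\<lambda>h. dir_deriv (h *\<^sub>R v) f (a + t *\<^sub>R v))) (at t)"
    by (simp add: o_def)
  moreover have "dir_deriv (h *\<^sub>R v) f (a + t *\<^sub>R v) = h *\<^sub>R dir_deriv v f (a + t *\<^sub>R v)" for h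
    using linear_frechet_derivative[OF assms] by (simp add: dir_deriv_def linear_scale)
  ultimately show ?thesis
    by (simp add: has_vector_derivative_def)
qed

lemma DERIV_along_line:
  fixes f :: "'a::real_normed_vector \<Rightarrow> real"
  assumes "f differentiable at (a + t *\<^sub>R v)"
  shows "((\<lambda>t. f (a + t *\<^sub>R v)) has_real_derivative dir_deriv v f (a + t *\<^sub>R v)) (at t)"
  using has_vector_derivative_along_line[OF assms]
  by (simp add: has_real_derivative_iff_has_vector_derivative)

text \<open>
  Directional derivatives commute with translations, so they inherit the periods of a function.
\<close>

lemma dir_deriv_shift:
  "dir_deriv v f (y + c) = dir_deriv v (\<lambda>z. f (z + c)) y"
proof -
  have "(f has_derivative D) (at (y + c)) \<longleftrightarrow> ((\<lambda>z. f (z + c)) has_derivative D) (at y)" for D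
  proof
    assume "(f has_derivative D) (at (y + c))"
    moreover have "((\<lambda>z. z + c) has_derivative (\<lambda>h. h)) (at y)"
      by (auto intro!: derivative_eq_intros)
    ultimately show "((\<lambda>z. f (z + c)) has_derivative D) (at y)"
      using diff_chain_at[of "\<lambda>z. z + c" "\<lambda>h. h" y f D] by (simp add: o_def)
  next
    assume "((\<lambda>z. f (z + c)) has_derivative D) (at y)"
    moreover have "((\<lambda>z. z - c) has_derivative (\<lambda>h. h)) (at (y + c))"
      by (auto intro!: derivative_eq_intros)
    ultimately show "(f has_derivative D) (at (y + c))"
      using diff_chain_at[of "\<lambda>z. z - c" "\<lambda>h. h" "y + c" "\<lambda>z. f (z + c)" D]
      by (simp add: o_def)
  qed
  then show ?thesis by (simp add: dir_deriv_def frechet_derivative_def)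
qed

lemma periodic_dir_deriv:
  "(\<And>w. f (w + c) = f w) \<Longrightarrow> dir_deriv v f (w + c) = dir_deriv v f w"
  for f :: "real ^ 2 \<Rightarrow> 'b::real_normed_vector"
  by (simp add: dir_deriv_shift)

text \<open>
  Applying the mean value theorem first in direction \<open>u\<close> and then in direction \<open>v\<close> writes the
  second difference of \<open>f\<close> as a mixed derivative at an intermediate point. The left-hand side is
  symmetric in \<open>u\<close> and \<open>v\<close>, which is what makes the mixed derivatives agree in the limit.
\<close>

lemma mixed_difference_eq:
  fixes f :: "'a::real_normed_vector \<Rightarrow> real"
  assumes f: "\<And>z. f differentiable at z" and fu: "\<And>z. dir_deriv u f differentiable at z"
    and "h > 0"
  obtains s t where "0 < s" "s < h" "0 < t" "t < h"
    "f (w + h *\<^sub>R u + h *\<^sub>R v) - f (w + h *\<^sub>R u) - f (w + h *\<^sub>R v) + f w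
      = h * h * dir_deriv v (dir_deriv u f) (w + s *\<^sub>R u + t *\<^sub>R v)"
proof -
  define k where "k = (\<lambda>s. f ((w + h *\<^sub>R v) + s *\<^sub>R u) - f (w + s *\<^sub>R u))"
  have "(k has_real_derivative
      dir_deriv u f ((w + h *\<^sub>R v) + s *\<^sub>R u) - dir_deriv u f (w + s *\<^sub>R u)) (at s)" for s
    unfolding k_def by (intro DERIV_diff DERIV_along_line f)
  from MVT2[OF \<open>h > 0\<close> this] obtain s where s: "0 < s" "s < h"
    "k h - k 0 = h * (dir_deriv u f ((w + h *\<^sub>R v) + s *\<^sub>R u) - dir_deriv u f (w + s *\<^sub>R u))"
    by auto
  have "((\<lambda>t. dir_deriv u f ((w + s *\<^sub>R u) + t *\<^sub>R v)) has_real_derivative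
      dir_deriv v (dir_deriv u f) ((w + s *\<^sub>R u) + t *\<^sub>R v)) (at t)" for t
    by (intro DERIV_along_line fu)
  from MVT2[OF \<open>h > 0\<close> this] obtain t where t: "0 < t" "t < h"
    "dir_deriv u f ((w + s *\<^sub>R u) + h *\<^sub>R v) - dir_deriv u f (w + s *\<^sub>R u)
      = h * dir_deriv v (dir_deriv u f) (w + s *\<^sub>R u + t *\<^sub>R v)"
    by auto
  have "k h - k 0 = h * h * dir_deriv v (dir_deriv u f) (w + s *\<^sub>R u + t *\<^sub>R v)"
  proof -
    have "(w + h *\<^sub>R v) + s *\<^sub>R u = (w + s *\<^sub>R u) + h *\<^sub>R v" by simp
    then show ?thesis unfolding s(3) using t(3) by (metis mult.assoc)
  qed
  then show ?thesis
    by (intro that[OF s(1,2) t(1,2)]) (simp add: k_def add_ac)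
qed

lemma dir_deriv_commute_real:
  fixes f :: "'a::real_normed_vector \<Rightarrow> real"
  assumes f: "\<And>z. f differentiable at z"
    and fu: "\<And>z. dir_deriv u f differentiable at z" and fv: "\<And>z. dir_deriv v f differentiable at z"
    and cuv: "isCont (dir_deriv v (dir_deriv u f)) w" and cvu: "isCont (dir_deriv u (dir_deriv v f)) w"
  shows "dir_deriv v (dir_deriv u f) w = dir_deriv u (dir_deriv v f) w"
proof -
  define h where "h = (\<lambda>n. inverse (real (Suc n)))"
  have hpos: "h n > 0" for n by (simp add: h_def)
  have h0: "h \<longlonglongrightarrow> 0" unfolding h_def by (rule LIMSEQ_inverse_real_of_nat)
  have near: "norm ((w + s *\<^sub>R a + t *\<^sub>R b) - w) \<le> h n * (norm a + norm b)"
    if "0 < s" "s < h n" "0 < t" "t < h n" for s t n and a b :: 'a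
  proof -
    have "norm ((w + s *\<^sub>R a + t *\<^sub>R b) - w) \<le> s * norm a + t * norm b"
      using norm_triangle_ineq[of "s *\<^sub>R a" "t *\<^sub>R b"] that by simp
    also have "\<dots> \<le> h n * norm a + h n * norm b"
      using that by (intro add_mono mult_right_mono) auto
    finally show ?thesis by (simp add: distrib_left)
  qed
  have "\<exists>z z'. norm (z - w) \<le> h n * (norm u + norm v) \<and> norm (z' - w) \<le> h n * (norm v + norm u)
      \<and> dir_deriv v (dir_deriv u f) z = dir_deriv u (dir_deriv v f) z'" for n
  proof -
    obtain s t where 1: "0 < s" "s < h n" "0 < t" "t < h n"
      "f (w + h n *\<^sub>R u + h n *\<^sub>R v) - f (w + h n *\<^sub>R u) - f (w + h n *\<^sub>R v) + f w
        = h n * h n * dir_deriv v (dir_deriv u f) (w + s *\<^sub>R u + t *\<^sub>R v)"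
      using mixed_difference_eq[OF f fu hpos[of n], of w v] by blast
    obtain s' t' where 2: "0 < s'" "s' < h n" "0 < t'" "t' < h n"
      "f (w + h n *\<^sub>R v + h n *\<^sub>R u) - f (w + h n *\<^sub>R v) - f (w + h n *\<^sub>R u) + f w
        = h n * h n * dir_deriv u (dir_deriv v f) (w + s' *\<^sub>R v + t' *\<^sub>R u)"
      using mixed_difference_eq[OF f fv hpos[of n], of w u] by blast
    have "h n * h n * dir_deriv v (dir_deriv u f) (w + s *\<^sub>R u + t *\<^sub>R v)
        = h n * h n * dir_deriv u (dir_deriv v f) (w + s' *\<^sub>R v + t' *\<^sub>R u)"
      unfolding 1(5)[symmetric] 2(5)[symmetric] by (simp add: add_ac)
    then have "dir_deriv v (dir_deriv u f) (w + s *\<^sub>R u + t *\<^sub>R v)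
        = dir_deriv u (dir_deriv v f) (w + s' *\<^sub>R v + t' *\<^sub>R u)"
      using hpos[of n] by simp
    with near[OF 1(1-4)] near[OF 2(1-4)] show ?thesis by blast
  qed
  then obtain z z' where
    z: "\<And>n. norm (z n - w) \<le> h n * (norm u + norm v)"
    and z': "\<And>n. norm (z' n - w) \<le> h n * (norm v + norm u)"
    and eq: "\<And>n. dir_deriv v (dir_deriv u f) (z n) = dir_deriv u (dir_deriv v f) (z' n)"
    by metis
  have conv: "r \<longlonglongrightarrow> w" if r: "\<And>n. norm (r n - w) \<le> h n * C" for r C
  proof -
    have "(\<lambda>n. h n * C) \<longlonglongrightarrow> 0" using tendsto_mult_right[OF h0, of C] by simp
    then have "(\<lambda>n. r n - w) \<longlonglongrightarrow> 0"
      by (rule Lim_null_comparison[rotated]) (simp add: r)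
    then show ?thesis by (simp add: LIM_zero_iff)
  qed
  have "(\<lambda>n. dir_deriv v (dir_deriv u f) (z n)) \<longlonglongrightarrow> dir_deriv v (dir_deriv u f) w"
    by (rule isCont_tendsto_compose[OF cuv conv[OF z]])
  moreover have "(\<lambda>n. dir_deriv u (dir_deriv v f) (z' n)) \<longlonglongrightarrow> dir_deriv u (dir_deriv v f) w"
    by (rule isCont_tendsto_compose[OF cvu conv[OF z']])
  ultimately show ?thesis
    unfolding eq by (rule LIMSEQ_unique)
qed

lemma differentiable_inner_const:
  "f differentiable (at w) \<Longrightarrow> (\<lambda>z. f z \<bullet> b) differentiable (at w)"
  by (rule differentiable_inner) auto

text \<open>
  Schwarz's theorem, reduced to real functions by pairing with the vectors of a basis.
\<close>

lemma dir_deriv_commute: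
  fixes f :: "'a::real_normed_vector \<Rightarrow> 'b::euclidean_space"
  assumes f: "\<And>z. f differentiable at z"
    and fu: "\<And>z. dir_deriv u f differentiable at z" and fv: "\<And>z. dir_deriv v f differentiable at z"
    and fuv: "\<And>z. dir_deriv v (dir_deriv u f) differentiable at z"
    and fvu: "\<And>z. dir_deriv u (dir_deriv v f) differentiable at z"
  shows "dir_deriv v (dir_deriv u f) = dir_deriv u (dir_deriv v f)"
proof (rule ext, rule euclidean_eqI)
  fix w and b :: 'b
  have 1: "dir_deriv v (\<lambda>z. f z \<bullet> b) = (\<lambda>z. dir_deriv v f z \<bullet> b)" for v
    by (rule ext, rule dir_deriv_bounded_linear[OF bounded_linear_inner_left f])
  have 2: "dir_deriv u (\<lambda>z. dir_deriv v f z \<bullet> b) = (\<lambda>z. dir_deriv u (dir_deriv v f) z \<bullet> b)"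
    if "\<And>z. dir_deriv v f differentiable at z" for u v
    by (rule ext, rule dir_deriv_bounded_linear[OF bounded_linear_inner_left that])
  have 3: "dir_deriv v (dir_deriv u (\<lambda>z. f z \<bullet> b)) = (\<lambda>z. dir_deriv v (dir_deriv u f) z \<bullet> b)"
    unfolding 1 by (rule 2[OF fu])
  have 4: "dir_deriv u (dir_deriv v (\<lambda>z. f z \<bullet> b)) = (\<lambda>z. dir_deriv u (dir_deriv v f) z \<bullet> b)"
    unfolding 1 by (rule 2[OF fv])
  have "dir_deriv v (dir_deriv u (\<lambda>z. f z \<bullet> b)) w = dir_deriv u (dir_deriv v (\<lambda>z. f z \<bullet> b)) w"
  proof (rule dir_deriv_commute_real)
    show "isCont (dir_deriv v (dir_deriv u (\<lambda>z. f z \<bullet> b))) w"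
      unfolding 3 by (intro differentiable_imp_continuous_within differentiable_inner_const fuv)
    show "isCont (dir_deriv u (dir_deriv v (\<lambda>z. f z \<bullet> b))) w"
      unfolding 4 by (intro differentiable_imp_continuous_within differentiable_inner_const fvu)
    show "(\<lambda>z. f z \<bullet> b) differentiable at z" for z
      by (rule differentiable_inner_const[OF f])
    show "dir_deriv u (\<lambda>z. f z \<bullet> b) differentiable at z" for z
      unfolding 1 by (rule differentiable_inner_const[OF fu])
    show "dir_deriv v (\<lambda>z. f z \<bullet> b) differentiable at z" for z
      unfolding 1 by (rule differentiable_inner_const[OF fv])
  qed
  then show "dir_deriv v (dir_deriv u f) w \<bullet> b = dir_deriv u (dir_deriv v f) w \<bullet> b"
    unfolding 3 4 .
qed

section \<open>Functions of one and two real variables\<close>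

text \<open>
  Stokes' theorem on a torus, for a one-form \<open>(P, Q)\<close> whose curl \<open>\<partial>\<^sub>v P - \<partial>\<^sub>u Q = k\<close> has a sign. The
  circle integral \<open>I(v) = \<integral> P(t, v) dt\<close> has derivative \<open>\<integral> k(t, v) dt \<ge> 0\<close>, because \<open>\<partial>\<^sub>u Q\<close>
  integrates to zero over a period; being monotone and periodic, \<open>I\<close> is constant.
  Then \<open>k\<close> integrates to zero over the circle, which is taken to start at the given point \<open>u\<close>.
\<close>

lemma periodic_curl_nonneg_imp_zero:
  fixes P Q Pv :: "real \<Rightarrow> real \<Rightarrow> real" and L :: real
  assumes dP: "\<And>u v. ((\<lambda>v. P u v) has_real_derivative Pv u v) (at v)"
    and dQ: "\<And>u v. ((\<lambda>u. Q u v) has_real_derivative Pv u v - k u v) (at u)"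
    and contPv: "continuous_on UNIV (\<lambda>(u, v). Pv u v)"
    and contP: "continuous_on UNIV (\<lambda>(u, v). P u v)"
    and contk: "continuous_on UNIV (\<lambda>(u, v). k u v)"
    and perP: "\<And>u v. P u (v + L) = P u v" and perQ: "\<And>u v. Q (u + L) v = Q u v"
    and k: "\<And>u v. k u v \<ge> 0" and L: "L > 0"
  shows "k u v = 0"
proof -
  have cont1: "continuous_on S (\<lambda>u. f u v)"
    if "continuous_on UNIV (\<lambda>(u, v). f u v)" for f :: "real \<Rightarrow> real \<Rightarrow> real" and S v
  proof -
    have "continuous_on S ((\<lambda>(u, v). f u v) \<circ> (\<lambda>u. (u, v)))"
      by (intro continuous_on_compose continuous_intros continuous_on_subset[OF that]) auto
    then show ?thesis by (simp add: o_def)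
  qed
  define I where "I = (\<lambda>v. integral (cbox u (u + L)) (\<lambda>t. P t v))"
  have contPv': "continuous_on (UNIV \<times> cbox u (u + L)) (\<lambda>(v, u). Pv u v)"
  proof -
    have "continuous_on (UNIV \<times> cbox u (u + L)) ((\<lambda>(u, v). Pv u v) \<circ> (\<lambda>(v, u). (u, v)))"
      unfolding split_beta
      by (intro continuous_on_compose continuous_intros
          continuous_on_subset[OF contPv[unfolded split_beta]]) auto
    then show ?thesis by (simp add: o_def split_beta)
  qed
  have dI: "(I has_real_derivative integral (cbox u (u + L)) (\<lambda>t. Pv t v)) (at v)" for v
  proof -
    have "((\<lambda>v. integral (cbox u (u + L)) (\<lambda>t. P t v)) has_field_derivative
        integral (cbox u (u + L)) (\<lambda>t. Pv t v)) (at v within UNIV)"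
      by (rule leibniz_rule_field_derivative[of UNIV u "u + L" "\<lambda>v u. P u v" "\<lambda>v u. Pv u v"])
         (auto intro!: dP integrable_continuous_interval cont1[OF contP] contPv'[simplified])
    then show ?thesis by (simp add: I_def)
  qed
  have "((\<lambda>t. Pv t v - k t v) has_integral Q (u + L) v - Q u v) {u..u + L}" for v
    by (rule fundamental_theorem_of_calculus)
       (use L in \<open>auto simp: has_real_derivative_iff_has_vector_derivative[symmetric]
          intro: has_field_derivative_at_within dQ\<close>)
  then have "integral (cbox u (u + L)) (\<lambda>t. Pv t v - k t v) = 0" for v
    by (simp add: perQ integral_unique)
  moreover have "integral (cbox u (u + L)) (\<lambda>t. Pv t v - k t v)
      = integral (cbox u (u + L)) (\<lambda>t. Pv t v) - integral (cbox u (u + L)) (\<lambda>t. k t v)" for v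
    by (rule integral_diff) (auto intro!: integrable_continuous_interval cont1 contPv contk)
  ultimately have eq: "integral (cbox u (u + L)) (\<lambda>t. Pv t v)
      = integral (cbox u (u + L)) (\<lambda>t. k t v)" for v
    by (metis right_minus_eq)
  have mono: "I a \<le> I b" if "a \<le> b" for a b
  proof (rule DERIV_nonneg_imp_nondecreasing[OF that])
    show "\<exists>y. DERIV I x :> y \<and> 0 \<le> y" for x
      using dI[of x] unfolding eq
      by (intro exI conjI, assumption)
         (auto intro!: integral_nonneg k integrable_continuous_interval cont1 contk)
  qed
  have per: "I (v + L) = I v" for v by (simp add: I_def perP)
  have const: "I (v - L) = I t" if "t \<in> {v - L<..<v + L}" for t
    using mono[of "v - L" t] mono[of t "v + L"] that per[of v] per[of "v - L"] by simp
  have "(I has_real_derivative 0) (at v)"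
    by (rule has_field_derivative_transform_within_open
        [of "\<lambda>_. I (v - L)" 0 v "{v - L<..<v + L}", OF DERIV_const _ _ const]) (use L in auto)
  from DERIV_unique[OF this dI] eq have "integral (cbox u (u + L)) (\<lambda>t. k t v) = 0" by simp
  then have "((\<lambda>t. k t v) has_integral 0) (cbox u (u + L))"
    using integrable_integral[OF integrable_continuous[OF cont1[OF contk]]] by metis
  from has_integral_0_cbox_imp_0[of u "u + L" "\<lambda>t. k t v", OF cont1[OF contk] k this]
  show ?thesis using L by simp
qed

text \<open>
  The differential inequality makes \<open>\<phi> t * exp (- C * t)\<close> nonincreasing, with \<open>C\<close> a bound of \<open>M\<close> on \<open>[0, T]\<close>.
\<close>

lemma gronwall_zero_right:
  fixes \<phi> \<phi>' M :: "real \<Rightarrow> real"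
  assumes d: "\<And>t. (\<phi> has_real_derivative \<phi>' t) (at t)"
    and M: "continuous_on UNIV M" and le: "\<And>t. \<bar>\<phi>' t\<bar> \<le> M t * \<phi> t"
    and nn: "\<And>t. \<phi> t \<ge> 0" and 0: "\<phi> 0 = 0" and T: "T \<ge> 0"
  shows "\<phi> T = 0"
proof -
  have "compact (M ` {0..T})"
    by (intro compact_continuous_image continuous_on_subset[OF M]) auto
  then obtain C where C: "\<And>t. t \<in> {0..T} \<Longrightarrow> M t \<le> C"
    using compact_imp_bounded bounded_iff by (metis abs_le_D1 imageI real_norm_def)
  have "\<phi> T * exp (- C * T) \<le> \<phi> 0 * exp (- C * 0)"
  proof (rule DERIV_nonpos_imp_nonincreasing[OF T])
    fix t assume t: "0 \<le> t" "t \<le> T"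
    have "((\<lambda>t. \<phi> t * exp (- C * t)) has_real_derivative (\<phi>' t - C * \<phi> t) * exp (- C * t)) (at t)"
      by (auto intro!: derivative_eq_intros d simp: algebra_simps)
    moreover have "\<phi>' t - C * \<phi> t \<le> 0"
      using le[of t] mult_right_mono[OF C nn, of t t] t by auto
    ultimately show "\<exists>y. ((\<lambda>t. \<phi> t * exp (- C * t)) has_real_derivative y) (at t) \<and> y \<le> 0"
      by (intro exI[of _ "(\<phi>' t - C * \<phi> t) * exp (- C * t)"]) (simp add: mult_nonpos_nonneg)
  qed
  with 0 nn[of T] show ?thesis by (simp add: mult_le_0_iff)
qed

lemma gronwall_zero:
  fixes \<phi> \<phi>' M :: "real \<Rightarrow> real"
  assumes d: "\<And>t. (\<phi> has_real_derivative \<phi>' t) (at t)"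
    and M: "continuous_on UNIV M" and le: "\<And>t. \<bar>\<phi>' t\<bar> \<le> M t * \<phi> t"
    and nn: "\<And>t. \<phi> t \<ge> 0" and 0: "\<phi> 0 = 0"
  shows "\<phi> T = 0"
proof (cases "T \<ge> 0")
  case True
  then show ?thesis by (rule gronwall_zero_right[OF assms])
next
  case False
  have "\<phi> (- (- T)) = 0"
  proof (rule gronwall_zero_right[where \<phi> = "\<lambda>t. \<phi> (- t)" and T = "- T" and M = "\<lambda>t. M (- t)"
        and \<phi>' = "\<lambda>t. - \<phi>' (- t)"])
    show "((\<lambda>t. \<phi> (- t)) has_real_derivative - \<phi>' (- t)) (at t)" for t
      using DERIV_chain2[OF d[of "- t"] DERIV_minus[OF DERIV_ident]] by simp
    show "continuous_on UNIV (\<lambda>t. M (- t))"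
      by (intro continuous_on_compose2[OF M] continuous_intros) auto
  qed (use le nn 0 False in auto)
  then show ?thesis by simp
qed

lemma second_derivative_at_max:
  fixes \<gamma> \<gamma>' :: "real \<Rightarrow> real"
  assumes d: "\<And>t. (\<gamma> has_real_derivative \<gamma>' t) (at t)" and d2: "(\<gamma>' has_real_derivative c) (at 0)"
    and max: "\<And>t. \<gamma> t \<le> \<gamma> 0" and crit: "\<gamma>' 0 = 0"
  shows "c \<le> 0"
proof (rule ccontr)
  assume "\<not> c \<le> 0"
  then obtain e where e: "e > 0" "\<And>h. 0 < h \<Longrightarrow> h < e \<Longrightarrow> \<gamma>' 0 < \<gamma>' (0 + h)"
    using DERIV_pos_inc_right[OF d2] by auto
  obtain z where "0 < z" "z < e / 2" "\<gamma> (e / 2) - \<gamma> 0 = (e / 2 - 0) * \<gamma>' z"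
    using MVT2[of 0 "e / 2" \<gamma> \<gamma>'] d e(1) by auto
  moreover have "\<gamma>' z > 0" using e(2)[of z] crit calculation by simp
  ultimately show False using max[of "e / 2"] e(1) by (smt (verit) mult_pos_pos half_gt_zero)
qed

text \<open>
  A doubly periodic function takes all its values on the fundamental square.
\<close>

lemma periodic_reduce:
  fixes f :: "real ^ 2 \<Rightarrow> 'b"
  assumes per: "\<And>w i. f (w + (2 * pi) *\<^sub>R axis i 1) = f w"
  obtains w' where "w' \<in> cbox 0 (\<chi> i. 2 * pi)" "f w' = f w"
proof -
  have nat: "f (w + (2 * pi * real n) *\<^sub>R axis i 1) = f w" for w i n
  proof (induction n)
    case (Suc n)
    have "w + (2 * pi * real (Suc n)) *\<^sub>R axis i 1
        = (w + (2 * pi * real n) *\<^sub>R axis i 1) + (2 * pi) *\<^sub>R axis i 1"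
      by (simp add: algebra_simps)
    then show ?case using per Suc by metis
  qed simp
  have int: "f (w + (2 * pi * of_int n) *\<^sub>R axis i 1) = f w" for w i n
  proof (cases "n \<ge> 0")
    case True
    then show ?thesis using nat[of w "nat n" i] by simp
  next
    case False
    then show ?thesis
      using nat[of "w + (2 * pi * of_int n) *\<^sub>R axis i 1" "nat (- n)" i]
      by (simp add: scaleR_left_distrib[symmetric] add.assoc)
  qed
  \<comment> \<open>the number of periods by which coordinate \<open>i\<close> has to be shifted\<close>
  define k where "k = (\<lambda>i. - \<lfloor>w $ i / (2 * pi)\<rfloor>)"
  define w' where "w' = w + (2 * pi * of_int (k 1)) *\<^sub>R axis 1 1 + (2 * pi * of_int (k 2)) *\<^sub>R axis 2 1"
  have "0 \<le> w $ i + 2 * pi * of_int (k i) \<and> w $ i + 2 * pi * of_int (k i) \<le> 2 * pi" for i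
  proof -
    have "of_int \<lfloor>w $ i / (2 * pi)\<rfloor> \<le> w $ i / (2 * pi)" "w $ i / (2 * pi) \<le> of_int \<lfloor>w $ i / (2 * pi)\<rfloor> + 1"
      by linarith+
    then have "of_int \<lfloor>w $ i / (2 * pi)\<rfloor> * (2 * pi) \<le> w $ i"
      "w $ i \<le> (of_int \<lfloor>w $ i / (2 * pi)\<rfloor> + 1) * (2 * pi)"
      by (simp_all only: pos_le_divide_eq pos_divide_le_eq pi_gt_zero zero_less_mult_iff zero_less_numeral simp_thms)
    then show ?thesis by (simp add: k_def algebra_simps)
  qed
  then have "w' \<in> cbox 0 (\<chi> i. 2 * pi)"
    by (simp add: w'_def mem_box_cart forall_2 axis_def)
  moreover have "f w' = f w" by (simp add: w'_def int)
  ultimately show ?thesis by (rule that)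
qed

section \<open>Linear algebra\<close>

text \<open>
  A subspace meets its orthogonal complement only in 0, so the defining property determines the projection.
\<close>

lemma orth_proj_eqI:
  assumes "subspace V" "b \<in> V" "a - b \<in> V\<^sup>\<bottom>"
  shows "orth_proj V a = b"
  unfolding orth_proj_def
proof (rule the_equality)
  fix c assume c: "c \<in> V \<and> a - c \<in> V\<^sup>\<bottom>"
  have "c - b \<in> V" using c assms(1,2) by (blast intro: subspace_diff)
  moreover have "(a - b) - (a - c) \<in> V\<^sup>\<bottom>"
    using c assms(3) by (blast intro: subspace_diff subspace_orthogonal_comp)
  ultimately have "(c - b) \<bullet> ((a - b) - (a - c)) = 0"
    unfolding orthogonal_comp_def orthogonal_def by blast
  then have "(c - b) \<bullet> (c - b) = 0" by simp
  then show "c = b" by simp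
qed (use assms in auto)

lemma matrix_inv_unique:
  fixes A :: "'a::semiring_1 ^ 'n ^ 'm"
  assumes "A ** B = mat 1" "B ** A = mat 1"
  shows "matrix_inv A = B"
  unfolding matrix_inv_def
proof (rule some_equality)
  fix C assume "A ** C = mat 1 \<and> C ** A = mat 1"
  then show "C = B"
    by (metis assms matrix_mul_assoc matrix_mul_lid matrix_mul_rid)
qed (use assms in simp)

lemma matrix_inv_2:
  fixes A :: "real ^ 2 ^ 2"
  assumes "det A \<noteq> 0"
  shows "matrix_inv A $ 1 $ 1 = A $ 2 $ 2 / det A" "matrix_inv A $ 1 $ 2 = - A $ 1 $ 2 / det A"
    "matrix_inv A $ 2 $ 1 = - A $ 2 $ 1 / det A" "matrix_inv A $ 2 $ 2 = A $ 1 $ 1 / det A"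
proof -
  define B :: "real ^ 2 ^ 2" where
    "B = vector [vector [A $ 2 $ 2 / det A, - A $ 1 $ 2 / det A],
                 vector [- A $ 2 $ 1 / det A, A $ 1 $ 1 / det A]]"
  have "a * b / det A + c * d / det A = (a * b + c * d) / det A" for a b c d
    by (simp add: add_divide_distrib)
  moreover have "A $ 1 $ 1 * A $ 2 $ 2 - A $ 1 $ 2 * A $ 2 $ 1 = det A"
    by (simp add: det_2)
  ultimately have "A ** B = mat 1" "B ** A = mat 1"
    using assms by (simp_all add: B_def vec_eq_iff forall_2 matrix_matrix_mult_def sum_2 mat_def
        field_simps)
  then have "matrix_inv A = B"
    by (rule matrix_inv_unique)
  then show "matrix_inv A $ 1 $ 1 = A $ 2 $ 2 / det A" "matrix_inv A $ 1 $ 2 = - A $ 1 $ 2 / det A"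
    "matrix_inv A $ 2 $ 1 = - A $ 2 $ 1 / det A" "matrix_inv A $ 2 $ 2 = A $ 1 $ 1 / det A"
    by (simp_all add: B_def)
qed

text \<open>
  The equality case of the Cauchy-Schwarz inequality, in a form symmetric in the two vectors.
\<close>

lemma gram_zero_imp_dependent:
  fixes v w :: "'a::real_inner"
  assumes "(v \<bullet> v) * (w \<bullet> w) - (v \<bullet> w)\<^sup>2 = 0"
  obtains a b where "a \<noteq> 0 \<or> b \<noteq> 0" "a *\<^sub>R v + b *\<^sub>R w = 0"
proof (cases "v = 0")
  case True
  then show ?thesis by (intro that[of 1 0]) auto
next
  case False
  \<comment> \<open>a multiple of the component of \<open>w\<close> orthogonal to \<open>v\<close>, without denominators\<close>
  let ?z = "(- (v \<bullet> w)) *\<^sub>R v + (v \<bullet> v) *\<^sub>R w"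
  have "?z \<bullet> ?z = (v \<bullet> v) * ((v \<bullet> v) * (w \<bullet> w) - (v \<bullet> w)\<^sup>2)"
    by (simp add: inner_add_left inner_add_right inner_commute[of w v] power2_eq_square algebra_simps)
  then have "?z = 0" using assms by simp
  with False show ?thesis by (intro that[of "- (v \<bullet> w)" "v \<bullet> v"]) auto
qed

lemma pairwise_orthogonal_card_le:
  fixes S :: "'a::euclidean_space set"
  assumes "pairwise orthogonal S" "0 \<notin> S" "finite S"
  shows "card S \<le> DIM('a)"
  using independent_bound[OF pairwise_orthogonal_independent[OF assms(1,2)]] by simp

text \<open>
  Otherwise the component of \<open>y\<close> orthogonal to \<open>p\<close> would, together with \<open>p\<close>, \<open>t\<close> and \<open>b\<close>, give four
  mutually orthogonal nonzero vectors in a space of dimension three.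
\<close>

lemma collinear_if_orthogonal_frame_3:
  fixes p y t b :: "real ^ 3"
  assumes "p \<bullet> p = 1" "t \<noteq> 0" "b \<noteq> 0" "t \<bullet> p = 0" "b \<bullet> p = 0" "t \<bullet> b = 0" "t \<bullet> y = 0" "b \<bullet> y = 0"
  shows "y = (y \<bullet> p) *\<^sub>R p"
proof (rule ccontr)
  let ?v = "y - (y \<bullet> p) *\<^sub>R p"
  assume "\<not> ?thesis"
  then have v: "?v \<noteq> 0" by simp
  have o: "p \<bullet> ?v = 0" "t \<bullet> ?v = 0" "b \<bullet> ?v = 0"
    using assms by (simp_all add: inner_diff_right inner_commute)
  have p: "p \<noteq> 0" using assms by auto
  have "p \<noteq> t" "p \<noteq> b" "p \<noteq> ?v" "t \<noteq> b" "t \<noteq> ?v" "b \<noteq> ?v"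
    using p assms o v by (metis inner_eq_zero_iff inner_commute)+
  then have "card {p, t, b, ?v} = 4" by simp
  moreover have "card {p, t, b, ?v} \<le> DIM(real ^ 3)"
    by (rule pairwise_orthogonal_card_le)
       (use assms o p v in \<open>auto simp: pairwise_insert orthogonal_def inner_commute\<close>)
  ultimately show False by simp
qed

lemma collinear_if_orthogonal_frame_2:
  fixes p y t :: "real ^ 2"
  assumes "p \<bullet> p = 1" "t \<noteq> 0" "t \<bullet> p = 0" "t \<bullet> y = 0"
  shows "y = (y \<bullet> p) *\<^sub>R p"
proof (rule ccontr)
  let ?v = "y - (y \<bullet> p) *\<^sub>R p"
  assume "\<not> ?thesis"
  then have v: "?v \<noteq> 0" by simp
  have o: "p \<bullet> ?v = 0" "t \<bullet> ?v = 0"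
    using assms by (simp_all add: inner_diff_right inner_commute)
  have p: "p \<noteq> 0" using assms by auto
  have "p \<noteq> t" "p \<noteq> ?v" "t \<noteq> ?v"
    using p assms o v by (metis inner_eq_zero_iff inner_commute)+
  then have "card {p, t, ?v} = 3" by simp
  moreover have "card {p, t, ?v} \<le> DIM(real ^ 2)"
    by (rule pairwise_orthogonal_card_le)
       (use assms o p v in \<open>auto simp: pairwise_insert orthogonal_def inner_commute\<close>)
  ultimately show False by simp
qed

lemma unit_multiple_nonneg:
  fixes y p :: "'a::real_inner"
  assumes "y \<bullet> y = 1" "p \<bullet> p = 1" "y = (y \<bullet> p) *\<^sub>R p" "y \<bullet> p \<ge> 0"
  shows "y = p"
proof -
  have "y \<bullet> y = (y \<bullet> p) * (y \<bullet> p)"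
    using arg_cong[OF assms(3), of "\<lambda>z. y \<bullet> z"] by simp
  then have "(y \<bullet> p)\<^sup>2 = 1" using assms(1) by (simp add: power2_eq_square)
  with assms(4) have "y \<bullet> p = 1" by (simp add: power2_eq_1_iff)
  with assms(3) show ?thesis by simp
qed

lemma exists_orthogonal_to_two:
  fixes u v :: "real ^ 3"
  obtains b where "norm b = 1" "u \<bullet> b = 0" "v \<bullet> b = 0"
proof -
  have "dim (span {u, v}) \<le> card {u, v}" by (simp add: dim_le_card')
  also have "\<dots> \<le> 2" by (simp add: card_insert_if)
  finally have "dim (span {u, v}) < DIM(real ^ 3)" by simp
  then obtain b where b: "b \<noteq> 0" "\<And>y. y \<in> span {u, v} \<Longrightarrow> orthogonal b y"
    using orthogonal_to_subspace_exists[of "{u, v}"] by (metis dim_span)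
  then have "u \<bullet> b = 0" "v \<bullet> b = 0"
    using b(2)[of u] b(2)[of v] by (simp_all add: span_base orthogonal_def inner_commute)
  with b(1) show ?thesis by (intro that[of "b /\<^sub>R norm b"]) auto
qed

section \<open>The sectional curvature of the ambient space\<close>

text \<open>
  The component of \<open>a\<close> orthogonal to \<open>z\<close>, that is, the projection to the tangent space of the sphere through \<open>z\<close>.
\<close>

definition rejection :: "'a::real_inner \<Rightarrow> 'a \<Rightarrow> 'a" where
  "rejection z a = a - (a \<bullet> z / (z \<bullet> z)) *\<^sub>R z"

lemma rejection_inner [simp]: "z \<noteq> 0 \<Longrightarrow> rejection z a \<bullet> z = 0"
  by (simp add: rejection_def inner_diff_left)

lemma rejection_idem [simp]: "rejection z (rejection z a) = rejection z a"
  by (cases "z = 0") (simp_all add: rejection_def inner_diff_left)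

lemma rejection_ident: "a \<bullet> z = 0 \<Longrightarrow> rejection z a = a"
  by (simp add: rejection_def)

lemma rejection_scaleR: "rejection z (c *\<^sub>R a) = c *\<^sub>R rejection z a"
  by (simp add: rejection_def algebra_simps)

lemma rejection_add: "rejection z (a + b) = rejection z a + rejection z b"
  by (simp add: rejection_def inner_add_left add_divide_distrib algebra_simps)

lemma rejection_self [simp]: "rejection z z = 0"
  by (cases "z = 0") (simp_all add: rejection_def)

lemma orth_proj_tangent_space:
  assumes "fst z \<noteq> 0" "snd z \<noteq> 0"
  shows "orth_proj (tangent_space z) a = (rejection (fst z) (fst a), rejection (snd z) (snd a))"
proof (rule orth_proj_eqI)
  show "subspace (tangent_space z)"
    by (auto simp: subspace_def tangent_space_def inner_add_left)
  show "(rejection (fst z) (fst a), rejection (snd z) (snd a)) \<in> tangent_space z"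
    using assms by (simp add: tangent_space_def)
  show "a - (rejection (fst z) (fst a), rejection (snd z) (snd a)) \<in> (tangent_space z)\<^sup>\<bottom>"
    by (auto simp: orthogonal_comp_def orthogonal_def tangent_space_def rejection_def inner_prod_def
        inner_commute)
qed

lemma has_derivative_rejection:
  fixes z :: "'a::real_inner"
  assumes "z \<noteq> 0"
  shows "((\<lambda>z. rejection z b) has_derivative
    (\<lambda>h. - ((b \<bullet> h) / (z \<bullet> z) - (b \<bullet> z) * (2 * (z \<bullet> h)) / (z \<bullet> z)\<^sup>2) *\<^sub>R z
         - ((b \<bullet> z) / (z \<bullet> z)) *\<^sub>R h)) (at z)"
  unfolding rejection_def using assms
  by (auto intro!: derivative_eq_intros simp: fun_eq_iff power2_eq_square divide_simps inner_commute
      algebra_simps)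

lemma open_nonzero_components: "open {z :: 'a::real_normed_vector \<times> 'b::real_normed_vector. fst z \<noteq> 0 \<and> snd z \<noteq> 0}"
  by (intro open_Collect_conj open_Collect_neq continuous_intros)

text \<open>
  For the projection \<open>C\<close> of a constant field \<open>c\<close>, the derivative of \<open>C\<close> consists of a radial part, which the
  tangential projection kills, and \<open>- (c \<bullet> z) / |z|\<^sup>2\<close> times the direction, in each factor. The formula is
  needed on a whole neighbourhood of \<open>S2xS1\<close>, since it is differentiated again.
\<close>

lemma levi_civita_projected_constant:
  assumes "fst z \<noteq> 0" "snd z \<noteq> 0"
  shows "levi_civita V (\<lambda>z. orth_proj (tangent_space z) c) z
    = ((- (fst c \<bullet> fst z) / (fst z \<bullet> fst z)) *\<^sub>R rejection (fst z) (fst (V z)),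
       (- (snd c \<bullet> snd z) / (snd z \<bullet> snd z)) *\<^sub>R rejection (snd z) (snd (V z)))"
proof -
  let ?d = "\<lambda>b z h. - ((b \<bullet> h) / (z \<bullet> z) - (b \<bullet> z) * (2 * (z \<bullet> h)) / (z \<bullet> z)\<^sup>2) *\<^sub>R z
         - ((b \<bullet> z) / (z \<bullet> z)) *\<^sub>R h"
  have r: "rejection z (?d b z h) = (- (b \<bullet> z) / (z \<bullet> z)) *\<^sub>R rejection z h" for b z h :: "'c::real_inner"
    by (simp only: diff_conv_add_uminus rejection_add scaleR_minus_left[symmetric] rejection_scaleR
        rejection_self) simp
  have d: "((\<lambda>w. (rejection (fst w) (fst c), rejection (snd w) (snd c))) has_derivative
      (\<lambda>h. (?d (fst c) (fst z) (fst h), ?d (snd c) (snd z) (snd h)))) (at z)"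
    using assms
    by (intro has_derivative_Pair
        has_derivative_compose[where f = fst, OF _ has_derivative_rejection]
        has_derivative_compose[where f = snd, OF _ has_derivative_rejection] derivative_intros)
       auto
  have "((\<lambda>w. orth_proj (tangent_space w) c) has_derivative
      (\<lambda>h. (?d (fst c) (fst z) (fst h), ?d (snd c) (snd z) (snd h)))) (at z)"
    by (rule has_derivative_transform_within_open[OF d open_nonzero_components])
       (use assms in \<open>auto simp: orth_proj_tangent_space\<close>)
  from frechet_derivative_at[OF this, symmetric] have "frechet_derivative (\<lambda>w. orth_proj (tangent_space w) c) (at z) h
      = (?d (fst c) (fst z) (fst h), ?d (snd c) (snd z) (snd h))" for h
    by (simp only:)
  then show ?thesis
    unfolding levi_civita_def orth_proj_tangent_space[OF assms] by (simp only: fst_conv snd_conv r)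
qed

text \<open>
  At a point where \<open>c\<close> is tangent the factor \<open>c \<bullet> z\<close> of the first derivative vanishes, so only the term in
  which this factor is differentiated survives.
\<close>

lemma levi_civita_levi_civita_projected_constant:
  assumes y: "y \<in> S2xS1" and t: "b \<in> tangent_space y" "c \<in> tangent_space y"
  shows "levi_civita V (levi_civita (\<lambda>z. orth_proj (tangent_space z) b)
           (\<lambda>z. orth_proj (tangent_space z) c)) y
    = (- (fst c \<bullet> fst (V y)) *\<^sub>R fst b, - (snd c \<bullet> snd (V y)) *\<^sub>R snd b)"
proof -
  let ?s = "\<lambda>b c z. (- (c \<bullet> z) / (z \<bullet> z)) *\<^sub>R rejection z b"
  have nz: "fst y \<noteq> 0" "snd y \<noteq> 0" and 1: "fst y \<bullet> fst y = 1" "snd y \<bullet> snd y = 1"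
    using y by (auto simp: S2xS1_def dot_square_norm)
  have t': "fst b \<bullet> fst y = 0" "snd b \<bullet> snd y = 0" "fst c \<bullet> fst y = 0" "snd c \<bullet> snd y = 0"
    using t by (auto simp: tangent_space_def)
  have ds: "(?s b c has_derivative (\<lambda>h. - (c \<bullet> h) *\<^sub>R b)) (at z)"
    if z: "z \<bullet> z = 1" "b \<bullet> z = 0" "c \<bullet> z = 0" for b c z :: "'c::real_inner"
  proof -
    have "z \<noteq> 0" using z by auto
    then have "((\<lambda>z. - (c \<bullet> z) / (z \<bullet> z)) has_derivative (\<lambda>h. - (c \<bullet> h))) (at z)"
      using z by (auto intro!: derivative_eq_intros simp: fun_eq_iff)
    from has_derivative_scaleR[OF this has_derivative_rejection[OF \<open>z \<noteq> 0\<close>, of b]]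
    show ?thesis
      using z by (simp add: rejection_ident)
  qed
  have d: "((\<lambda>w. (?s (fst b) (fst c) (fst w), ?s (snd b) (snd c) (snd w))) has_derivative
      (\<lambda>h. (- (fst c \<bullet> fst h) *\<^sub>R fst b, - (snd c \<bullet> snd h) *\<^sub>R snd b))) (at y)"
    by (intro has_derivative_Pair
        has_derivative_compose[where f = fst, OF _ ds]
        has_derivative_compose[where f = snd, OF _ ds] derivative_intros 1 t')
  have "(levi_civita (\<lambda>z. orth_proj (tangent_space z) b) (\<lambda>z. orth_proj (tangent_space z) c)
      has_derivative (\<lambda>h. (- (fst c \<bullet> fst h) *\<^sub>R fst b, - (snd c \<bullet> snd h) *\<^sub>R snd b))) (at y)"
    by (rule has_derivative_transform_within_open[OF d open_nonzero_components])
       (use nz in \<open>auto simp: orth_proj_tangent_space levi_civita_projected_constant\<close>)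
  from frechet_derivative_at[OF this, symmetric] have "frechet_derivative (levi_civita (\<lambda>z. orth_proj (tangent_space z) b)
        (\<lambda>z. orth_proj (tangent_space z) c)) (at y) h
      = (- (fst c \<bullet> fst h) *\<^sub>R fst b, - (snd c \<bullet> snd h) *\<^sub>R snd b)" for h
    by (simp only:)
  then show ?thesis
    unfolding levi_civita_def[of V] orth_proj_tangent_space[OF nz]
    by (simp add: rejection_scaleR rejection_ident t')
qed

text \<open>
  The bracket of the two extended fields vanishes at \<open>y\<close>, and the second derivatives give
  \<open>R(a, b) b = |b|\<^sup>2 a - (a \<bullet> b) b\<close> in each factor. The result is a sum of two Gram
  determinants, hence nonnegative.
\<close>

lemma sectional_curvature_S2xS1:
  assumes y: "y \<in> S2xS1" and t: "a \<in> tangent_space y" "b \<in> tangent_space y"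
  shows "sectional_curvature y a b
    = ((fst a \<bullet> fst a) * (fst b \<bullet> fst b) - (fst a \<bullet> fst b)\<^sup>2
       + ((snd a \<bullet> snd a) * (snd b \<bullet> snd b) - (snd a \<bullet> snd b)\<^sup>2))
      / ((a \<bullet> a) * (b \<bullet> b) - (a \<bullet> b)\<^sup>2)"
proof -
  have nz: "fst y \<noteq> 0" "snd y \<noteq> 0"
    using y by (auto simp: S2xS1_def)
  have t': "fst b \<bullet> fst y = 0" "snd b \<bullet> snd y = 0" "fst a \<bullet> fst y = 0" "snd a \<bullet> snd y = 0"
    using t by (auto simp: tangent_space_def)
  have P: "orth_proj (tangent_space y) a = a" "orth_proj (tangent_space y) b = b"
    using t' by (simp_all add: orth_proj_tangent_space nz rejection_ident)
  let ?P = "\<lambda>a z. orth_proj (tangent_space z) a"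
  have "curvature_op (?P a) (?P b) (?P b) y
      = (- (fst b \<bullet> fst a) *\<^sub>R fst b, - (snd b \<bullet> snd a) *\<^sub>R snd b)
        - (- (fst b \<bullet> fst b) *\<^sub>R fst a, - (snd b \<bullet> snd b) *\<^sub>R snd a)"
    unfolding curvature_op_def levi_civita_levi_civita_projected_constant[OF y t(2) t(2)]
      levi_civita_levi_civita_projected_constant[OF y t(1) t(2)]
      levi_civita_projected_constant[OF nz] P
    using t' by simp
  then have "curvature_op (?P a) (?P b) (?P b) y \<bullet> a
      = (fst a \<bullet> fst a) * (fst b \<bullet> fst b) - (fst a \<bullet> fst b)\<^sup>2
        + ((snd a \<bullet> snd a) * (snd b \<bullet> snd b) - (snd a \<bullet> snd b)\<^sup>2)"
    by (simp add: inner_prod_def inner_diff_left inner_commute power2_eq_square algebra_simps)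
  then show ?thesis
    unfolding sectional_curvature_def Let_def by simp
qed

section \<open>Surfaces and the Gauss equation\<close>

text \<open>
  A surface patch defined on the whole plane, such as the lift of an immersed torus to its universal
  covering.
\<close>

locale S2xS1_surface =
  fixes X :: "real ^ 2 \<Rightarrow> ambient"
  assumes smooth: "smooth_on UNIV X"
    and immersion: "inj (frechet_derivative X (at w))"
    and in_S2xS1: "X w \<in> S2xS1"

begin

abbreviation "dX i \<equiv> partial_deriv i X"
abbreviation "ddX i j \<equiv> partial_deriv i (partial_deriv j X)"
abbreviation "dddX i j k \<equiv> partial_deriv i (partial_deriv j (partial_deriv k X))"
abbreviation "g \<equiv> induced_metric X"
abbreviation "\<Gamma> \<equiv> christoffel g"
abbreviation "II \<equiv> second_fund_form X"

text \<open>
  The Christoffel symbols of the first kind. For a surface in Euclidean space they are the inner products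
  of second and first derivatives, because the derivatives of the metric combine to these.
\<close>

definition christoffel1 :: "2 \<Rightarrow> 2 \<Rightarrow> 2 \<Rightarrow> real ^ 2 \<Rightarrow> real" where
  "christoffel1 i j l w = ddX i j w \<bullet> dX l w"

lemma differentiable_iterated: "foldr dir_deriv vs X differentiable at w"
  using smooth by (simp add: smooth_on_def differentiable_on_def)

lemma differentiable_X: "X differentiable at w"
  and differentiable_dX: "dX i differentiable at w"
  and differentiable_ddX: "ddX i j differentiable at w"
  and differentiable_dddX: "dddX i j k differentiable at w"
  using differentiable_iterated[of "[]"] differentiable_iterated[of "[axis i 1]"]
    differentiable_iterated[of "[axis i 1, axis j 1]"]
    differentiable_iterated[of "[axis i 1, axis j 1, axis k 1]"] by simp_all

lemma ddX_commute: "ddX i j = ddX j i"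
  by (rule dir_deriv_commute) (rule differentiable_X differentiable_dX differentiable_ddX)+

lemma dddX_commute: "dddX i j k = dddX j i k"
  by (rule dir_deriv_commute) (rule differentiable_dX differentiable_ddX differentiable_dddX)+

lemma christoffel1_commute: "christoffel1 i j = christoffel1 j i"
  by (simp add: christoffel1_def fun_eq_iff ddX_commute)

lemma frechet_derivative_X: "frechet_derivative X (at w) h = h $ 1 *\<^sub>R dX 1 w + h $ 2 *\<^sub>R dX 2 w"
proof -
  have "dir_deriv h X w = h $ 1 *\<^sub>R dX 1 w + h $ 2 *\<^sub>R dX 2 w"
    by (rule dir_deriv_expand[OF differentiable_X])
  then show ?thesis unfolding dir_deriv_def[of h] .
qed

lemma dX_independent:
  assumes "a *\<^sub>R dX 1 w + b *\<^sub>R dX 2 w = 0"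
  shows "a = 0" "b = 0"
proof -
  have "frechet_derivative X (at w) (vector [a, b]) = frechet_derivative X (at w) 0"
    using assms by (simp add: frechet_derivative_X)
  then have "vector [a, b] = (0 :: real ^ 2)"
    by (rule injD[OF immersion])
  then show "a = 0" "b = 0"
    by (simp_all add: vec_eq_iff forall_2)
qed

lemma g_eq: "g w $ i $ j = dX i w \<bullet> dX j w"
  by (simp add: induced_metric_def)

lemma g_commute: "g w $ i $ j = g w $ j $ i"
  by (simp add: g_eq inner_commute)

lemma g11_pos: "g w $ 1 $ 1 > 0"
  using dX_independent(1)[of 1 w 0] by (auto simp: g_eq)

lemma det_g: "det (g w) = g w $ 1 $ 1 * g w $ 2 $ 2 - (g w $ 1 $ 2)\<^sup>2"
  by (simp add: det_2 power2_eq_square g_commute[of w 2 1])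

text \<open>
  By the Gram-Schmidt vector: its squared length is \<open>g\<^sub>1\<^sub>1\<close> times the determinant.
\<close>

lemma det_g_pos: "det (g w) > 0"
proof -
  let ?v = "(- g w $ 1 $ 2) *\<^sub>R dX 1 w + g w $ 1 $ 1 *\<^sub>R dX 2 w"
  have "?v \<noteq> 0" using dX_independent(2)[of "- g w $ 1 $ 2" w "g w $ 1 $ 1"] g11_pos[of w] by auto
  then have "?v \<bullet> ?v > 0" by simp
  also have "?v \<bullet> ?v = g w $ 1 $ 1 * det (g w)"
    by (simp add: det_g inner_add_left inner_add_right g_eq[symmetric] g_commute[of w 2 1]
        power2_eq_square algebra_simps)
  finally show ?thesis using g11_pos[of w] by (simp add: zero_less_mult_iff)
qed

lemma partial_g: "partial_deriv i (\<lambda>z. g z $ j $ l) w = christoffel1 i j l w + christoffel1 i l j w"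
  by (simp add: g_eq dir_deriv_inner differentiable_dX christoffel1_def inner_commute)

lemma differentiable_g: "(\<lambda>z. g z $ j $ l) differentiable at w"
  by (simp add: g_eq differentiable_inner differentiable_dX)

lemma differentiable_christoffel1: "christoffel1 i j l differentiable at w"
  using differentiable_inner[OF differentiable_ddX differentiable_dX]
  by (simp add: christoffel1_def[abs_def])

lemma partial_christoffel1:
  "partial_deriv i (christoffel1 j k l) w = ddX j k w \<bullet> ddX i l w + dddX i j k w \<bullet> dX l w"
  by (simp add: christoffel1_def[abs_def] dir_deriv_inner differentiable_dX differentiable_ddX)

lemma \<Gamma>_eq:
  "\<Gamma> 1 i j w = (g w $ 2 $ 2 * christoffel1 i j 1 w - g w $ 1 $ 2 * christoffel1 i j 2 w) / det (g w)"
  "\<Gamma> 2 i j w = (g w $ 1 $ 1 * christoffel1 i j 2 w - g w $ 1 $ 2 * christoffel1 i j 1 w) / det (g w)"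
proof -
  have "partial_deriv i (\<lambda>z. g z $ j $ l) w + partial_deriv j (\<lambda>z. g z $ i $ l) w
      - partial_deriv l (\<lambda>z. g z $ i $ j) w = 2 * christoffel1 i j l w" for l
    unfolding partial_g using christoffel1_commute by simp
  then show "\<Gamma> 1 i j w = (g w $ 2 $ 2 * christoffel1 i j 1 w - g w $ 1 $ 2 * christoffel1 i j 2 w) / det (g w)"
    "\<Gamma> 2 i j w = (g w $ 1 $ 1 * christoffel1 i j 2 w - g w $ 1 $ 2 * christoffel1 i j 1 w) / det (g w)"
    using det_g_pos[of w]
    by (simp_all add: christoffel_def sum_2 matrix_inv_2 g_commute[of w 2 1] diff_divide_distrib)
qed

text \<open>
  Equivalently, \<open>\<Gamma>\<^sup>1 dX 1 + \<Gamma>\<^sup>2 dX 2\<close> is the tangential component of the second derivative of \<open>X\<close>.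
\<close>

lemma \<Gamma>_lower: "\<Gamma> 1 i j w * g w $ 1 $ m + \<Gamma> 2 i j w * g w $ 2 $ m = christoffel1 i j m w"
proof -
  have "m = 1 \<or> m = 2" by (rule exhaust_2)
  moreover have "det (g w) \<noteq> 0" using det_g_pos[of w] by simp
  ultimately show ?thesis
    unfolding \<Gamma>_eq
    by (elim disjE; simp add: field_simps g_commute[of w 2 1])
       (simp_all add: det_g power2_eq_square algebra_simps)
qed

lemma differentiable_\<Gamma>: "\<Gamma> k i j differentiable at w"
proof -
  have nz: "det (g z) \<noteq> 0" for z using det_g_pos[of z] by simp
  have "(\<lambda>z. det (g z)) differentiable at w"
    unfolding det_g by (intro differentiable_diff differentiable_mult differentiable_power differentiable_g)
  then have "\<Gamma> 1 i j differentiable at w" "\<Gamma> 2 i j differentiable at w"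
    unfolding \<Gamma>_eq[abs_def]
    by (intro differentiable_divide differentiable_diff differentiable_mult differentiable_g
        differentiable_christoffel1 nz; assumption)+
  then show ?thesis using exhaust_2[of k] by auto
qed

text \<open>
  Differentiating the lowered symbols avoids differentiating the inverse of the metric.
\<close>

lemma partial_\<Gamma>_lower:
  "g w $ 1 $ m * partial_deriv i (\<Gamma> 1 j k) w + g w $ 2 $ m * partial_deriv i (\<Gamma> 2 j k) w
   = partial_deriv i (christoffel1 j k m) w
     - \<Gamma> 1 j k w * (christoffel1 i 1 m w + christoffel1 i m 1 w)
     - \<Gamma> 2 j k w * (christoffel1 i 2 m w + christoffel1 i m 2 w)"
proof -
  have "partial_deriv i (christoffel1 j k m) w
      = partial_deriv i (\<lambda>z. \<Gamma> 1 j k z * g z $ 1 $ m + \<Gamma> 2 j k z * g z $ 2 $ m) w"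
    by (simp add: \<Gamma>_lower)
  also have "\<dots> = \<Gamma> 1 j k w * partial_deriv i (\<lambda>z. g z $ 1 $ m) w
        + partial_deriv i (\<Gamma> 1 j k) w * g w $ 1 $ m
      + (\<Gamma> 2 j k w * partial_deriv i (\<lambda>z. g z $ 2 $ m) w
        + partial_deriv i (\<Gamma> 2 j k) w * g w $ 2 $ m)"
    by (simp only: dir_deriv_add dir_deriv_mult_real differentiable_mult differentiable_\<Gamma> differentiable_g)
  finally show ?thesis unfolding partial_g by (simp add: algebra_simps)
qed

text \<open>
  The Gauss equation of \<open>X\<close> as a surface in \<open>\<real>\<^sup>5\<close>: the terms with \<open>\<Gamma>\<close> remove from the inner products of
  second derivatives the contribution of their tangential components. The third derivatives
  of \<open>X\<close> cancel by Schwarz's theorem.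
\<close>

lemma gauss_equation_euclidean:
  "gauss_curvature g w * det (g w)
   = ddX 1 1 w \<bullet> ddX 2 2 w - ddX 1 2 w \<bullet> ddX 1 2 w
     - (\<Gamma> 1 2 2 w * christoffel1 1 1 1 w + \<Gamma> 2 2 2 w * christoffel1 1 1 2 w)
     + (\<Gamma> 1 1 2 w * christoffel1 1 2 1 w + \<Gamma> 2 1 2 w * christoffel1 1 2 2 w)"
proof -
  have "gauss_curvature g w * det (g w)
      = (g w $ 1 $ 1 * partial_deriv 1 (\<Gamma> 1 2 2) w + g w $ 2 $ 1 * partial_deriv 1 (\<Gamma> 2 2 2) w)
      - (g w $ 1 $ 1 * partial_deriv 2 (\<Gamma> 1 1 2) w + g w $ 2 $ 1 * partial_deriv 2 (\<Gamma> 2 1 2) w)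
      + \<Gamma> 1 2 2 w * (\<Gamma> 1 1 1 w * g w $ 1 $ 1 + \<Gamma> 2 1 1 w * g w $ 2 $ 1)
      + \<Gamma> 2 2 2 w * (\<Gamma> 1 1 2 w * g w $ 1 $ 1 + \<Gamma> 2 1 2 w * g w $ 2 $ 1)
      - \<Gamma> 1 1 2 w * (\<Gamma> 1 2 1 w * g w $ 1 $ 1 + \<Gamma> 2 2 1 w * g w $ 2 $ 1)
      - \<Gamma> 2 1 2 w * (\<Gamma> 1 2 2 w * g w $ 1 $ 1 + \<Gamma> 2 2 2 w * g w $ 2 $ 1)"
  proof -
    have "gauss_curvature g w * det (g w) = (\<Sum>l\<in>UNIV. g w $ l $ 1 * riemann g l 2 1 2 w)"
      using det_g_pos[of w] by (simp add: gauss_curvature_def)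
    then show ?thesis
      by (simp add: riemann_def sum_2 g_commute[of w 1 2] algebra_simps)
  qed
  then show ?thesis
    unfolding partial_\<Gamma>_lower \<Gamma>_lower partial_christoffel1
    using fun_cong[OF dddX_commute[of 1 2 2], of w] christoffel1_commute[of 2 1] ddX_commute[of 2 1]
    by (simp add: algebra_simps inner_commute)
qed

lemma X_on_spheres: "fst (X w) \<bullet> fst (X w) = 1" "snd (X w) \<bullet> snd (X w) = 1"
  using in_S2xS1[of w] by (auto simp: S2xS1_def dot_square_norm)

lemma partial_fst: "f differentiable at w \<Longrightarrow> partial_deriv i (\<lambda>z. fst (f z)) w = fst (partial_deriv i f w)"
  for f :: "real ^ 2 \<Rightarrow> ambient"
  by (rule dir_deriv_bounded_linear[OF bounded_linear_fst])

lemma partial_snd: "f differentiable at w \<Longrightarrow> partial_deriv i (\<lambda>z. snd (f z)) w = snd (partial_deriv i f w)"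
  for f :: "real ^ 2 \<Rightarrow> ambient"
  by (rule dir_deriv_bounded_linear[OF bounded_linear_snd])

lemma differentiable_fst: "f differentiable at w \<Longrightarrow> (\<lambda>z. fst (f z)) differentiable at w"
  and differentiable_snd: "f differentiable at w \<Longrightarrow> (\<lambda>z. snd (f z)) differentiable at w"
  for f :: "real ^ 2 \<Rightarrow> ambient"
  by (auto simp: differentiable_def intro: has_derivative_fst has_derivative_snd)

lemma dX_tangent: "fst (dX i w) \<bullet> fst (X w) = 0" "snd (dX i w) \<bullet> snd (X w) = 0"
proof -
  have "partial_deriv i (\<lambda>z. fst (X z) \<bullet> fst (X z)) w = 0"
    "partial_deriv i (\<lambda>z. snd (X z) \<bullet> snd (X z)) w = 0"
    unfolding X_on_spheres by (rule dir_deriv_const)+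
  then show "fst (dX i w) \<bullet> fst (X w) = 0" "snd (dX i w) \<bullet> snd (X w) = 0"
    by (simp_all add: dir_deriv_inner partial_fst partial_snd differentiable_fst differentiable_snd
        differentiable_X inner_commute)
qed

text \<open>
  Differentiating the orthogonality of \<open>X\<close> and its first derivatives, in each factor.
\<close>

lemma ddX_normal:
  "fst (ddX i j w) \<bullet> fst (X w) = - (fst (dX i w) \<bullet> fst (dX j w))"
  "snd (ddX i j w) \<bullet> snd (X w) = - (snd (dX i w) \<bullet> snd (dX j w))"
proof -
  have "partial_deriv i (\<lambda>z. fst (dX j z) \<bullet> fst (X z)) w = 0"
    "partial_deriv i (\<lambda>z. snd (dX j z) \<bullet> snd (X z)) w = 0"
    unfolding dX_tangent by (rule dir_deriv_const)+
  then show "fst (ddX i j w) \<bullet> fst (X w) = - (fst (dX i w) \<bullet> fst (dX j w))"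
    "snd (ddX i j w) \<bullet> snd (X w) = - (snd (dX i w) \<bullet> snd (dX j w))"
    by (simp_all add: dir_deriv_inner partial_fst partial_snd differentiable_fst differentiable_snd
        differentiable_X differentiable_dX inner_commute)
qed

lemma tangential_component_lower: "(\<Gamma> 1 i j w *\<^sub>R dX 1 w + \<Gamma> 2 i j w *\<^sub>R dX 2 w) \<bullet> dX m w = christoffel1 i j m w"
  using \<Gamma>_lower[of i j w m] by (simp add: inner_add_left g_eq)

text \<open>
  Subtracting from a second derivative its components normal to the two spheres and its component
  tangential to the surface.
\<close>

lemma second_fund_form_eq:
  "second_fund_form X i j w = ddX i j w
     + ((fst (dX i w) \<bullet> fst (dX j w)) *\<^sub>R fst (X w), (snd (dX i w) \<bullet> snd (dX j w)) *\<^sub>R snd (X w))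
     - (\<Gamma> 1 i j w *\<^sub>R dX 1 w + \<Gamma> 2 i j w *\<^sub>R dX 2 w)"
proof -
  let ?N = "((fst (dX i w) \<bullet> fst (dX j w)) *\<^sub>R fst (X w), (snd (dX i w) \<bullet> snd (dX j w)) *\<^sub>R snd (X w))"
  let ?T = "\<Gamma> 1 i j w *\<^sub>R dX 1 w + \<Gamma> 2 i j w *\<^sub>R dX 2 w"
  have nz: "fst (X w) \<noteq> 0" "snd (X w) \<noteq> 0"
    using in_S2xS1[of w] by (auto simp: S2xS1_def)
  have proj: "orth_proj (tangent_space (X w)) (ddX i j w) = ddX i j w + ?N"
    unfolding orth_proj_tangent_space[OF nz] rejection_def X_on_spheres ddX_normal
    by (simp add: prod_eq_iff)
  show ?thesis
    unfolding second_fund_form_def proj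
  proof (rule orth_proj_eqI[OF subspace_orthogonal_comp])
    have "dX m w \<bullet> ?N = 0" for m by (simp add: inner_prod_def dX_tangent)
    then have "dX m w \<bullet> (ddX i j w + ?N - ?T) = 0" for m
      using tangential_component_lower[of i j w m]
      by (simp add: inner_diff_right inner_add_right christoffel1_def inner_commute)
    then show "ddX i j w + ?N - ?T \<in> (tangent_plane X w)\<^sup>\<bottom>"
      by (auto simp: orthogonal_comp_def orthogonal_def tangent_plane_def frechet_derivative_X
          inner_add_left)
    have "?T = frechet_derivative X (at w) (vector [\<Gamma> 1 i j w, \<Gamma> 2 i j w])"
      by (simp add: frechet_derivative_X)
    then have T: "?T \<in> tangent_plane X w" by (simp only: tangent_plane_def rangeI)
    have eq: "ddX i j w + ?N - (ddX i j w + ?N - ?T) = ?T" by simp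
    show "ddX i j w + ?N - (ddX i j w + ?N - ?T) \<in> (tangent_plane X w)\<^sup>\<bottom>\<^sup>\<bottom>"
      unfolding eq using T by (rule subsetD[OF orthogonal_comp_subset])
  qed
qed

lemma II_commute: "II i j w = II j i w"
  by (simp add: second_fund_form_eq ddX_commute[of i j] inner_commute \<Gamma>_eq christoffel1_commute[of i j])

lemma II_normal:
  "II i j w \<bullet> dX m w = 0" "fst (II i j w) \<bullet> fst (X w) = 0" "snd (II i j w) \<bullet> snd (X w) = 0"
proof -
  show "II i j w \<bullet> dX m w = 0"
    using tangential_component_lower[of i j w m]
    by (simp add: second_fund_form_eq inner_add_left inner_diff_left christoffel1_def)
       (simp add: inner_prod_def dX_tangent inner_commute[of "fst (X w)"] inner_commute[of "snd (X w)"])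
  show "fst (II i j w) \<bullet> fst (X w) = 0" "snd (II i j w) \<bullet> snd (X w) = 0"
    by (simp_all add: second_fund_form_eq inner_add_left inner_diff_left ddX_normal dX_tangent X_on_spheres)
qed

lemma II_inner:
  "II i j w \<bullet> II k l w = ddX i j w \<bullet> ddX k l w
    - (fst (dX i w) \<bullet> fst (dX j w)) * (fst (dX k w) \<bullet> fst (dX l w))
    - (snd (dX i w) \<bullet> snd (dX j w)) * (snd (dX k w) \<bullet> snd (dX l w))
    - (\<Gamma> 1 i j w * christoffel1 k l 1 w + \<Gamma> 2 i j w * christoffel1 k l 2 w)"
proof -
  have "II i j w \<bullet> II k l w = II i j w \<bullet> ddX k l w"
    unfolding second_fund_form_eq[of k l w]
    by (simp add: inner_diff_right inner_add_right II_normal)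
       (simp add: inner_prod_def II_normal)
  also have "\<dots> = ddX i j w \<bullet> ddX k l w
     + ((fst (dX i w) \<bullet> fst (dX j w)) * (fst (ddX k l w) \<bullet> fst (X w))
       + (snd (dX i w) \<bullet> snd (dX j w)) * (snd (ddX k l w) \<bullet> snd (X w)))
    - (\<Gamma> 1 i j w * christoffel1 k l 1 w + \<Gamma> 2 i j w * christoffel1 k l 2 w)"
    by (simp add: second_fund_form_eq[of i j] inner_diff_left inner_add_left christoffel1_def
        inner_commute[of "dX _ w"])
       (simp add: inner_prod_def inner_commute)
  finally show ?thesis unfolding ddX_normal by simp
qed

definition ambient_curvature_numerator :: "real ^ 2 \<Rightarrow> real" where
  "ambient_curvature_numerator w =
     (fst (dX 1 w) \<bullet> fst (dX 1 w)) * (fst (dX 2 w) \<bullet> fst (dX 2 w)) - (fst (dX 1 w) \<bullet> fst (dX 2 w))\<^sup>2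
     + ((snd (dX 1 w) \<bullet> snd (dX 1 w)) * (snd (dX 2 w) \<bullet> snd (dX 2 w)) - (snd (dX 1 w) \<bullet> snd (dX 2 w))\<^sup>2)"

lemma ambient_curvature_eq: "ambient_curvature X w = ambient_curvature_numerator w / det (g w)"
  unfolding ambient_curvature_def ambient_curvature_numerator_def det_g g_eq
  by (rule sectional_curvature_S2xS1[OF in_S2xS1]) (simp_all add: tangent_space_def dX_tangent)

lemma ambient_curvature_numerator_nonneg: "ambient_curvature_numerator w \<ge> 0"
  unfolding ambient_curvature_numerator_def by (intro add_nonneg_nonneg; simp add: Cauchy_Schwarz_ineq)

text \<open>
  Passing from \<open>\<real>\<^sup>5\<close> to \<open>S2xS1\<close> in \<open>gauss_equation_euclidean\<close> splits off the components of the second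
  derivatives normal to the two spheres; these contribute exactly the curvature of \<open>S2xS1\<close>.
\<close>

lemma gauss_equation:
  "gauss_curvature g w = ambient_curvature X w + (II 1 1 w \<bullet> II 2 2 w - II 1 2 w \<bullet> II 1 2 w) / det (g w)"
proof -
  have "gauss_curvature g w * det (g w)
      = ambient_curvature_numerator w + (II 2 2 w \<bullet> II 1 1 w - II 1 2 w \<bullet> II 1 2 w)"
    unfolding gauss_equation_euclidean II_inner ambient_curvature_numerator_def
    by (simp add: inner_commute power2_eq_square algebra_simps)
  then show ?thesis
    using det_g_pos[of w] by (simp add: ambient_curvature_eq field_simps inner_commute)
qed

end

section \<open>The Willmore density as a sum of squares\<close>

text \<open>
  With \<open>E, F, G\<close> the metric and \<open>L, M, N\<close> the second fundamental form this is the inequality between \<open>H\<^sup>2\<close>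
  and the product of the principal curvatures, in arbitrary coordinates. As an identity
  between inner products it holds for vector-valued forms, so no unit normal has to be chosen.
\<close>

lemma sum_of_squares_identity:
  fixes L M N :: "'c::real_inner"
  assumes D: "D = E * G - F\<^sup>2"
  shows "E\<^sup>2 * ((norm (G *\<^sub>R L - (2 * F) *\<^sub>R M + E *\<^sub>R N))\<^sup>2 - 4 * D * (L \<bullet> N - M \<bullet> M))
    = 4 * D * (norm (E *\<^sub>R M - F *\<^sub>R L))\<^sup>2
      + (norm (E *\<^sub>R (E *\<^sub>R N - G *\<^sub>R L) - (2 * F) *\<^sub>R (E *\<^sub>R M - F *\<^sub>R L)))\<^sup>2"
  unfolding D power2_norm_eq_inner
  by (simp add: inner_diff_left inner_diff_right inner_add_left inner_add_right
      inner_commute[of M L] inner_commute[of N L] inner_commute[of N M] power2_eq_square)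
     (simp add: algebra_simps)

context S2xS1_surface
begin

lemma mean_curvature_vector_eq:
  "mean_curvature_vector X w = (1 / (2 * det (g w))) *\<^sub>R
     (g w $ 2 $ 2 *\<^sub>R II 1 1 w - (2 * g w $ 1 $ 2) *\<^sub>R II 1 2 w + g w $ 1 $ 1 *\<^sub>R II 2 2 w)"
proof -
  have "mean_curvature_vector X w = (1/2) *\<^sub>R
     ((g w $ 2 $ 2 / det (g w)) *\<^sub>R II 1 1 w + (- g w $ 1 $ 2 / det (g w)) *\<^sub>R II 1 2 w
      + ((- g w $ 1 $ 2 / det (g w)) *\<^sub>R II 1 2 w + (g w $ 1 $ 1 / det (g w)) *\<^sub>R II 2 2 w))"
    using det_g_pos[of w]
    by (simp add: mean_curvature_vector_def sum_2 matrix_inv_2 g_commute[of w 2 1] II_commute[of 2 1])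
  also have "\<dots> = (1 / (2 * det (g w))) *\<^sub>R
     (g w $ 2 $ 2 *\<^sub>R II 1 1 w - (2 * g w $ 1 $ 2) *\<^sub>R II 1 2 w + g w $ 1 $ 1 *\<^sub>R II 2 2 w)"
  proof -
    have "x + y + (y + z) = x + 2 *\<^sub>R y + z" for x y z :: ambient
      by (simp add: scaleR_2)
    then show ?thesis
      by (simp add: scaleR_add_right scaleR_diff_right)
  qed
  finally show ?thesis .
qed

text \<open>
  The right-hand side of \<open>sum_of_squares_identity\<close>. It vanishes exactly at the umbilic points, where the
  second fundamental form is a multiple of the metric.
\<close>

definition umbilicity_defect :: "real ^ 2 \<Rightarrow> real" where
  "umbilicity_defect w =
     4 * det (g w) * (norm (g w $ 1 $ 1 *\<^sub>R II 1 2 w - g w $ 1 $ 2 *\<^sub>R II 1 1 w))\<^sup>2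
     + (norm (g w $ 1 $ 1 *\<^sub>R (g w $ 1 $ 1 *\<^sub>R II 2 2 w - g w $ 2 $ 2 *\<^sub>R II 1 1 w)
         - (2 * g w $ 1 $ 2) *\<^sub>R (g w $ 1 $ 1 *\<^sub>R II 1 2 w - g w $ 1 $ 2 *\<^sub>R II 1 1 w)))\<^sup>2"

lemma willmore_density_eq:
  "(norm (mean_curvature_vector X w))\<^sup>2 - gauss_curvature g w + ambient_curvature X w
    = umbilicity_defect w / (4 * (det (g w))\<^sup>2 * (g w $ 1 $ 1)\<^sup>2)"
proof -
  let ?D = "det (g w)" and ?E = "g w $ 1 $ 1"
  let ?T = "g w $ 2 $ 2 *\<^sub>R II 1 1 w - (2 * g w $ 1 $ 2) *\<^sub>R II 1 2 w + g w $ 1 $ 1 *\<^sub>R II 2 2 w"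
  let ?q = "II 1 1 w \<bullet> II 2 2 w - II 1 2 w \<bullet> II 1 2 w"
  have "(norm (mean_curvature_vector X w))\<^sup>2 = (norm ?T)\<^sup>2 / (4 * ?D\<^sup>2)"
    by (simp add: mean_curvature_vector_eq power_divide power_mult_distrib)
  then have "(norm (mean_curvature_vector X w))\<^sup>2 - gauss_curvature g w + ambient_curvature X w
      = (norm ?T)\<^sup>2 / (4 * ?D\<^sup>2) - ?q / ?D"
    by (simp add: gauss_equation)
  also have "\<dots> = ((norm ?T)\<^sup>2 - 4 * ?D * ?q) / (4 * ?D\<^sup>2)"
    using det_g_pos[of w] by (simp add: diff_divide_distrib power2_eq_square)
  also have "\<dots> = (?E\<^sup>2 * ((norm ?T)\<^sup>2 - 4 * ?D * ?q)) / (4 * ?D\<^sup>2 * ?E\<^sup>2)"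
    using g11_pos[of w] by simp
  finally show ?thesis
    unfolding sum_of_squares_identity[OF det_g] umbilicity_defect_def .
qed

lemma umbilicity_defect_nonneg: "umbilicity_defect w \<ge> 0"
  unfolding umbilicity_defect_def using det_g_pos[of w] by simp

lemma umbilic:
  assumes "umbilicity_defect w = 0"
  obtains h where "II 1 1 w = g w $ 1 $ 1 *\<^sub>R h" "II 1 2 w = g w $ 1 $ 2 *\<^sub>R h" "II 2 2 w = g w $ 2 $ 2 *\<^sub>R h"
proof -
  have E: "g w $ 1 $ 1 \<noteq> 0" using g11_pos[of w] by simp
  have 1: "g w $ 1 $ 1 *\<^sub>R II 1 2 w = g w $ 1 $ 2 *\<^sub>R II 1 1 w"
    and 2: "g w $ 1 $ 1 *\<^sub>R II 2 2 w = g w $ 2 $ 2 *\<^sub>R II 1 1 w"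
    using assms det_g_pos[of w] E
    by (auto simp: umbilicity_defect_def add_nonneg_eq_0_iff)
  define h where "h = (1 / g w $ 1 $ 1) *\<^sub>R II 1 1 w"
  have L: "II 1 1 w = g w $ 1 $ 1 *\<^sub>R h" using E by (simp add: h_def)
  have 3: "g w $ 1 $ 1 *\<^sub>R II 1 2 w = g w $ 1 $ 1 *\<^sub>R (g w $ 1 $ 2 *\<^sub>R h)"
    and 4: "g w $ 1 $ 1 *\<^sub>R II 2 2 w = g w $ 1 $ 1 *\<^sub>R (g w $ 2 $ 2 *\<^sub>R h)"
    unfolding 1 2 L by (simp_all add: mult_ac)
  show ?thesis
    by (rule that[OF L scaleR_left_imp_eq[OF E 3] scaleR_left_imp_eq[OF E 4]])
qed

text \<open>
  At an umbilic point with \<open>II = g h\<close> the Gauss equation reads \<open>K = K' + |h|\<^sup>2\<close>, where the ambient curvature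
  \<open>K'\<close> is nonnegative. So \<open>K = 0\<close> forces both summands to vanish.
\<close>

lemma umbilic_gauss_curvature:
  assumes "umbilicity_defect w = 0"
  shows "gauss_curvature g w \<ge> ambient_curvature X w" "ambient_curvature X w \<ge> 0"
    and "gauss_curvature g w = 0 \<Longrightarrow> (\<forall>i j. II i j w = 0) \<and> ambient_curvature X w = 0"
proof -
  obtain h where h: "II 1 1 w = g w $ 1 $ 1 *\<^sub>R h" "II 1 2 w = g w $ 1 $ 2 *\<^sub>R h" "II 2 2 w = g w $ 2 $ 2 *\<^sub>R h"
    using umbilic[OF assms] .
  have "II 1 1 w \<bullet> II 2 2 w - II 1 2 w \<bullet> II 1 2 w = det (g w) * (h \<bullet> h)"
    by (simp add: h det_g power2_eq_square algebra_simps)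
  then have K: "gauss_curvature g w = ambient_curvature X w + h \<bullet> h"
    using det_g_pos[of w] by (simp add: gauss_equation)
  then show "gauss_curvature g w \<ge> ambient_curvature X w" by simp
  show nn: "ambient_curvature X w \<ge> 0"
    using ambient_curvature_numerator_nonneg[of w] det_g_pos[of w] by (simp add: ambient_curvature_eq)
  assume "gauss_curvature g w = 0"
  with K nn have "h \<bullet> h = 0" "ambient_curvature X w = 0" by (smt (verit) inner_ge_zero)+
  moreover from this have "II i j w = 0" for i j
    using h II_commute[of 2 1 w] exhaust_2[of i] exhaust_2[of j] by auto
  ultimately show "(\<forall>i j. II i j w = 0) \<and> ambient_curvature X w = 0" by blast
qed

end

section \<open>The curvature as an exact form\<close>

text \<open>
  The algebra behind \<open>curl_connection_form\<close>. The letters \<open>a, b, c, d, e, f\<close> stand for the Christoffel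
  symbols of the first kind with indices 111, 112, 121, 122, 221, 222; \<open>s\<close> and \<open>t\<close> are the
  inner products of second derivatives in the Gauss equation; \<open>m\<close> and \<open>T\<close> collect the
  terms common to both partial derivatives.
\<close>

lemma liouville_curvature_identity:
  fixes E F G D r a b c d e f s t m T :: real
  assumes D: "D = E * G - F\<^sup>2" and r: "r * r = D" "r > 0" and E: "E > 0"
    and K: "K * D = s - t - ((G * e - F * f) / D * a + (E * f - F * e) / D * b)
      + ((G * c - F * d) / D * c + (E * d - F * c) / D * d)"
  shows "((s + T - (((d + e) * E - F * (2 * c)) / E\<^sup>2 * a + F / E * m)) * r
        - (b - F / E * a) * ((2 * c * G + E * (2 * f) - 2 * F * (d + e)) / (2 * r))) / r\<^sup>2
    - ((t + T - (((b + c) * E - F * (2 * a)) / E\<^sup>2 * c + F / E * m)) * r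
        - (d - F / E * c) * ((2 * a * G + E * (2 * d) - 2 * F * (b + c)) / (2 * r))) / r\<^sup>2
    = K * r"
proof -
  have D0: "D > 0" using r by (metis mult_pos_pos)
  let ?P = "s + T - (((d + e) * E - F * (2 * c)) / E\<^sup>2 * a + F / E * m)"
  let ?Q = "t + T - (((b + c) * E - F * (2 * a)) / E\<^sup>2 * c + F / E * m)"
  let ?p = "(b - F / E * a) * (c * G + E * f - F * (d + e))"
  let ?q = "(d - F / E * c) * (a * G + E * d - F * (b + c))"
  have split: "(P * r - y * ((2 * z1 * G + E * (2 * z2) - 2 * F * z3) / (2 * r))) / r\<^sup>2 * r
      = P - y * (z1 * G + E * z2 - F * z3) / D" for P y z1 z2 z3
    unfolding r(1)[symmetric] using r(2) by (simp add: field_simps power2_eq_square)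
  have "?P - ?Q - (?p - ?q) / D = K * D"
  proof -
    have G: "G = (D + F\<^sup>2) / E" using D E by (simp add: field_simps)
    show ?thesis unfolding K G using E D0
      by (simp add: divide_simps) (simp add: algebra_simps power2_eq_square)
  qed
  also have "\<dots> = K * r * r" by (simp add: r(1)[symmetric])
  finally have "?P - ?p / D - (?Q - ?q / D) = K * r * r" by (simp add: diff_divide_distrib)
  then show ?thesis
    unfolding split[symmetric] left_diff_distrib[symmetric] using r(2) by simp
qed

context S2xS1_surface
begin

text \<open>
  The connection form \<open>\<omega>(\<partial>\<^sub>i) = \<nabla>\<^sub>i e\<^sub>1 \<bullet> e\<^sub>2\<close> of the orthonormal frame \<open>e\<^sub>1, e\<^sub>2\<close> that the Gram-Schmidt process
  makes of the coordinate frame.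
\<close>

definition connection_form :: "2 \<Rightarrow> real ^ 2 \<Rightarrow> real" where
  "connection_form i w =
     (christoffel1 i 1 2 w - g w $ 1 $ 2 / g w $ 1 $ 1 * christoffel1 i 1 1 w) / sqrt (det (g w))"

text \<open>
  The partial derivative of \<open>connection_form\<close> in direction \<open>j\<close>, written out by the quotient rule.
\<close>

definition partial_connection_form :: "2 \<Rightarrow> 2 \<Rightarrow> real ^ 2 \<Rightarrow> real" where
  "partial_connection_form j i w =
     (let E = g w $ 1 $ 1; F = g w $ 1 $ 2; G = g w $ 2 $ 2; r = sqrt (det (g w));
          E' = partial_deriv j (\<lambda>z. g z $ 1 $ 1) w; F' = partial_deriv j (\<lambda>z. g z $ 1 $ 2) w;
          G' = partial_deriv j (\<lambda>z. g z $ 2 $ 2) w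
      in ((partial_deriv j (christoffel1 i 1 2) w
            - ((F' * E - F * E') / E\<^sup>2 * christoffel1 i 1 1 w
               + F / E * partial_deriv j (christoffel1 i 1 1) w)) * r
          - (christoffel1 i 1 2 w - F / E * christoffel1 i 1 1 w)
            * ((E' * G + E * G' - 2 * F * F') / (2 * r))) / r\<^sup>2)"

lemma DERIV_connection_form:
  "((\<lambda>t. connection_form i (a + t *\<^sub>R axis j 1)) has_real_derivative
     partial_connection_form j i (a + t *\<^sub>R axis j 1)) (at t)"
proof -
  let ?l = "\<lambda>t. a + t *\<^sub>R axis j 1"
  let ?E = "\<lambda>t. g (?l t) $ 1 $ 1" and ?F = "\<lambda>t. g (?l t) $ 1 $ 2" and ?G = "\<lambda>t. g (?l t) $ 2 $ 2"
  let ?E' = "partial_deriv j (\<lambda>z. g z $ 1 $ 1) (?l t)" and ?F' = "partial_deriv j (\<lambda>z. g z $ 1 $ 2) (?l t)"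
    and ?G' = "partial_deriv j (\<lambda>z. g z $ 2 $ 2) (?l t)"
  note d = DERIV_along_line[where a = a and t = t and v = "axis j 1", OF differentiable_g]
    DERIV_along_line[where a = a and t = t and v = "axis j 1", OF differentiable_christoffel1]
  have D: "((\<lambda>t. sqrt (det (g (?l t)))) has_real_derivative
      (?E' * ?G t + ?E t * ?G' - 2 * ?F t * ?F') / (2 * sqrt (det (g (?l t))))) (at t)"
    using det_g_pos[of "?l t"] unfolding det_g
    by (auto intro!: derivative_eq_intros d simp: field_simps)
  have nz: "?E t \<noteq> 0" "sqrt (det (g (?l t))) \<noteq> 0"
    using g11_pos[of "?l t"] det_g_pos[of "?l t"] by auto
  have N: "((\<lambda>t. christoffel1 i 1 2 (?l t) - ?F t / ?E t * christoffel1 i 1 1 (?l t)) has_real_derivative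
      partial_deriv j (christoffel1 i 1 2) (?l t)
        - ((?F' * ?E t - ?F t * ?E') / (?E t)\<^sup>2 * christoffel1 i 1 1 (?l t)
           + ?F t / ?E t * partial_deriv j (christoffel1 i 1 1) (?l t))) (at t)"
    using nz by (auto intro!: derivative_eq_intros d simp: power2_eq_square) (simp add: field_simps)
  show ?thesis
    unfolding connection_form_def partial_connection_form_def Let_def power2_eq_square[of "sqrt _"]
    by (rule DERIV_divide[OF N D nz(2)])
qed

text \<open>
  The structure equation \<open>d\<omega> = - K dA\<close>. It exhibits the curvature as an exact form on a torus, where the
  coordinate frame is globally defined.
\<close>

lemma curl_connection_form:
  "partial_connection_form 2 1 w - partial_connection_form 1 2 w
    = gauss_curvature g w * sqrt (det (g w))"
proof -
  let ?E = "g w $ 1 $ 1" and ?F = "g w $ 1 $ 2" and ?G = "g w $ 2 $ 2" and ?D = "det (g w)"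
  let ?r = "sqrt (det (g w))" and ?c = "\<lambda>i j l. christoffel1 i j l w"
  let ?m = "ddX 1 1 w \<bullet> ddX 1 2 w + dddX 2 1 1 w \<bullet> dX 1 w" and ?T = "dddX 2 1 1 w \<bullet> dX 2 w"
  note c = christoffel1_commute[of 2 1] ddX_commute[of 2 1]
  have third: "dddX 1 1 2 w = dddX 2 1 1 w"
    using fun_cong[OF dddX_commute[of 1 2 1], of w] by (simp add: c)
  have K: "gauss_curvature g w * ?D = ddX 1 1 w \<bullet> ddX 2 2 w - ddX 1 2 w \<bullet> ddX 1 2 w
      - ((?G * ?c 2 2 1 - ?F * ?c 2 2 2) / ?D * ?c 1 1 1 + (?E * ?c 2 2 2 - ?F * ?c 2 2 1) / ?D * ?c 1 1 2)
      + ((?G * ?c 1 2 1 - ?F * ?c 1 2 2) / ?D * ?c 1 2 1 + (?E * ?c 1 2 2 - ?F * ?c 1 2 1) / ?D * ?c 1 2 2)"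
    unfolding gauss_equation_euclidean \<Gamma>_eq ..
  have r: "?r * ?r = ?D" "?r > 0"
    using det_g_pos[of w] by auto
  have "partial_connection_form 2 1 w =
    ((ddX 1 1 w \<bullet> ddX 2 2 w + ?T
        - (((?c 1 2 2 + ?c 2 2 1) * ?E - ?F * (2 * ?c 1 2 1)) / ?E\<^sup>2 * ?c 1 1 1 + ?F / ?E * ?m)) * ?r
     - (?c 1 1 2 - ?F / ?E * ?c 1 1 1)
       * ((2 * ?c 1 2 1 * ?G + ?E * (2 * ?c 2 2 2) - 2 * ?F * (?c 1 2 2 + ?c 2 2 1)) / (2 * ?r))) / ?r\<^sup>2"
    unfolding partial_connection_form_def Let_def partial_g partial_christoffel1 by (simp add: c)
  moreover have "partial_connection_form 1 2 w =
    ((ddX 1 2 w \<bullet> ddX 1 2 w + ?T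
        - (((?c 1 1 2 + ?c 1 2 1) * ?E - ?F * (2 * ?c 1 1 1)) / ?E\<^sup>2 * ?c 1 2 1 + ?F / ?E * ?m)) * ?r
     - (?c 1 2 2 - ?F / ?E * ?c 1 2 1)
       * ((2 * ?c 1 1 1 * ?G + ?E * (2 * ?c 1 2 2) - 2 * ?F * (?c 1 1 2 + ?c 1 2 1)) / (2 * ?r))) / ?r\<^sup>2"
    unfolding partial_connection_form_def Let_def partial_g partial_christoffel1
    by (simp add: c third inner_commute)
  ultimately show ?thesis
    using liouville_curvature_identity[OF det_g r g11_pos K] by simp
qed

lemma continuous_on_differentiable: "(\<And>w. f differentiable at w) \<Longrightarrow> continuous_on S f"
  for f :: "real ^ 2 \<Rightarrow> 'b::real_normed_vector"
  by (meson continuous_at_imp_continuous_on differentiable_imp_continuous_within)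

lemma continuous_intros_surface [continuous_intros]:
  "continuous_on S X" "continuous_on S (dX i)" "continuous_on S (ddX i j)" "continuous_on S (dddX i j k)"
  by (rule continuous_on_differentiable differentiable_X differentiable_dX differentiable_ddX
      differentiable_dddX)+

lemma continuous_g [continuous_intros]: "continuous_on S g"
  unfolding induced_metric_def[abs_def] by (intro continuous_on_vec_lambda continuous_intros)

lemma continuous_det_g [continuous_intros]: "continuous_on S (\<lambda>w. det (g w))"
  unfolding det_g by (intro continuous_intros)

lemma continuous_christoffel [continuous_intros]:
  "continuous_on S (christoffel1 i j l)" "continuous_on S (\<Gamma> i j l)"
  by (rule continuous_on_differentiable differentiable_christoffel1 differentiable_\<Gamma>)+

lemma continuous_partial_connection_form: "continuous_on S (partial_connection_form j i)"
proof -
  have nz: "g w $ 1 $ 1 \<noteq> 0" "sqrt (det (g w)) \<noteq> 0" "2 * sqrt (det (g w)) \<noteq> 0"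
    "(g w $ 1 $ 1)\<^sup>2 \<noteq> 0" "(sqrt (det (g w)))\<^sup>2 \<noteq> 0" for w
    using g11_pos[of w] det_g_pos[of w] by auto
  show ?thesis
    unfolding partial_connection_form_def[abs_def] Let_def partial_g partial_christoffel1
    by (intro continuous_intros ballI nz)
qed

lemma continuous_connection_form: "continuous_on S (connection_form i)"
proof -
  have nz: "g w $ 1 $ 1 \<noteq> 0" "sqrt (det (g w)) \<noteq> 0" "2 * sqrt (det (g w)) \<noteq> 0"
    "(g w $ 1 $ 1)\<^sup>2 \<noteq> 0" "(sqrt (det (g w)))\<^sup>2 \<noteq> 0" for w
    using g11_pos[of w] det_g_pos[of w] by auto
  show ?thesis
    unfolding connection_form_def[abs_def]
    by (intro continuous_intros ballI nz)
qed

lemma continuous_II [continuous_intros]: "continuous_on S (II i j)"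
  unfolding second_fund_form_eq[abs_def] by (intro continuous_intros)

lemma continuous_umbilicity_defect: "continuous_on S umbilicity_defect"
  unfolding umbilicity_defect_def[abs_def] by (intro continuous_intros)

end

section \<open>Umbilic tori are totally geodesic\<close>

locale S2xS1_torus = S2xS1_surface +
  assumes periodic: "X (w + (2 * pi) *\<^sub>R axis k 1) = X w"

begin

lemma periodic_dX: "dX i (w + (2 * pi) *\<^sub>R axis k 1) = dX i w"
  by (rule periodic_dir_deriv) (rule periodic)

lemma periodic_ddX: "ddX i j (w + (2 * pi) *\<^sub>R axis k 1) = ddX i j w"
  by (rule periodic_dir_deriv) (rule periodic_dX)

lemma periodic_g: "g (w + (2 * pi) *\<^sub>R axis k 1) = g w"
  by (simp add: induced_metric_def periodic_dX)

lemma periodic_christoffel1: "christoffel1 i j l (w + (2 * pi) *\<^sub>R axis k 1) = christoffel1 i j l w"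
  by (simp add: christoffel1_def periodic_dX periodic_ddX)

lemma periodic_II: "II i j (w + (2 * pi) *\<^sub>R axis k 1) = II i j w"
  by (simp add: second_fund_form_eq periodic periodic_dX periodic_ddX periodic_g \<Gamma>_eq periodic_christoffel1)

lemma periodic_umbilicity_defect: "umbilicity_defect (w + (2 * pi) *\<^sub>R axis k 1) = umbilicity_defect w"
  by (simp add: umbilicity_defect_def periodic_g periodic_II)

lemma periodic_connection_form: "connection_form i (w + (2 * pi) *\<^sub>R axis k 1) = connection_form i w"
  by (simp add: connection_form_def periodic_g periodic_christoffel1)

text \<open>
  The total curvature of a torus is zero, hence a nonnegative curvature vanishes. The connection form is
  periodic, so this is Stokes' theorem for it.
\<close>

lemma gauss_bonnet_nonneg:
  assumes nn: "\<And>w. gauss_curvature g w \<ge> 0"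
  shows "gauss_curvature g w = 0"
proof -
  define pt :: "real \<Rightarrow> real \<Rightarrow> real ^ 2" where "pt = (\<lambda>u v. u *\<^sub>R axis 1 1 + v *\<^sub>R axis 2 1)"
  define k where "k = (\<lambda>w. gauss_curvature g w * sqrt (det (g w)))"
  have k: "k = (\<lambda>w. partial_connection_form 2 1 w - partial_connection_form 1 2 w)"
    unfolding curl_connection_form k_def ..
  have pt_cont: "continuous_on UNIV (\<lambda>(u, v). f (pt u v))"
    if "continuous_on UNIV f" for f :: "real ^ 2 \<Rightarrow> real"
    unfolding split_beta pt_def
    by (intro continuous_on_compose2[OF that] continuous_intros) auto
  have "k (pt u v) = 0" for u v
  proof (rule periodic_curl_nonneg_imp_zero[where L = "2 * pi"
        and P = "\<lambda>u v. connection_form 1 (pt u v)" and Q = "\<lambda>u v. connection_form 2 (pt u v)"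
        and Pv = "\<lambda>u v. partial_connection_form 2 1 (pt u v)" and k = "\<lambda>u v. k (pt u v)"])
    fix u v
    show "((\<lambda>v. connection_form 1 (pt u v)) has_real_derivative partial_connection_form 2 1 (pt u v)) (at v)"
      unfolding pt_def by (rule DERIV_connection_form)
    have eq: "pt u v = v *\<^sub>R axis 2 1 + u *\<^sub>R axis 1 1" for u v by (simp add: pt_def)
    have "((\<lambda>u. connection_form 2 (pt u v)) has_real_derivative partial_connection_form 1 2 (pt u v)) (at u)"
      unfolding eq by (rule DERIV_connection_form)
    then show "((\<lambda>u. connection_form 2 (pt u v)) has_real_derivative
        partial_connection_form 2 1 (pt u v) - k (pt u v)) (at u)"
      by (simp add: k)
    show "connection_form 1 (pt u (v + 2 * pi)) = connection_form 1 (pt u v)"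
      using periodic_connection_form[of 1 "pt u v" 2]
      by (simp add: pt_def scaleR_left_distrib add.assoc)
    show "connection_form 2 (pt (u + 2 * pi) v) = connection_form 2 (pt u v)"
      using periodic_connection_form[of 2 "pt u v" 1]
      by (simp add: pt_def scaleR_left_distrib add_ac)
    show "k (pt u v) \<ge> 0"
      unfolding k_def using nn[of "pt u v"] det_g_pos[of "pt u v"] by simp
  qed (use k in \<open>auto intro!: pt_cont continuous_intros continuous_connection_form continuous_partial_connection_form\<close>)
  moreover have "w = pt (w $ 1) (w $ 2)"
    by (simp add: pt_def vec_eq_iff forall_2 axis_def)
  ultimately have "k w = 0" by metis
  then show ?thesis unfolding k_def using det_g_pos[of w] by simp
qed

text \<open>
  Here the topology enters. The map \<open>(y, t) \<mapsto> e\<^sup>t y\<close> from \<open>S\<^sup>2 \<times> \<real>\<close> to \<open>\<real>\<^sup>3\<close> is conformal, so round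
  spheres that miss the origin and are not centred there give umbilic spheres in \<open>S2xS1\<close> that are not totally geodesic. Umbilic surfaces have
  nonnegative curvature, and on a torus this curvature must vanish.
\<close>

lemma umbilic_torus:
  assumes "\<And>w. umbilicity_defect w = 0"
  shows "II i j w = 0" "ambient_curvature X w = 0"
proof -
  have "gauss_curvature g w \<ge> 0" for w
    using umbilic_gauss_curvature(1,2)[OF assms[of w]] by simp
  then have "gauss_curvature g w = 0" by (rule gauss_bonnet_nonneg)
  from umbilic_gauss_curvature(3)[OF assms this] show "II i j w = 0" "ambient_curvature X w = 0"
    by blast+
qed

lemma totally_geodesic_defect: "(\<And>i j w. II i j w = 0) \<Longrightarrow> umbilicity_defect w = 0"
  by (simp add: umbilicity_defect_def)

definition willmore_density :: "real ^ 2 \<Rightarrow> real" where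
  "willmore_density w = ((norm (mean_curvature_vector X w))\<^sup>2 - gauss_curvature g w + ambient_curvature X w)
                * sqrt (det (g w))"

lemma willmore_density_defect:
  "willmore_density w = umbilicity_defect w / (4 * (det (g w))\<^sup>2 * (g w $ 1 $ 1)\<^sup>2) * sqrt (det (g w))"
  by (simp add: willmore_density_def willmore_density_eq)

lemma willmore_density_nonneg: "willmore_density w \<ge> 0"
  unfolding willmore_density_defect
  using umbilicity_defect_nonneg[of w] det_g_pos[of w] by simp

lemma continuous_willmore_density: "continuous_on S willmore_density"
proof -
  have nz: "4 * (det (g w))\<^sup>2 * (g w $ 1 $ 1)\<^sup>2 \<noteq> 0" for w
    using g11_pos[of w] det_g_pos[of w] by simp
  show ?thesis
    unfolding willmore_density_defect[abs_def]
    by (intro continuous_intros continuous_umbilicity_defect ballI nz)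
qed

text \<open>
  A continuous nonnegative density with integral zero vanishes on the fundamental square, hence everywhere.
\<close>

lemma willmore_zero_imp_umbilic:
  assumes "integral (cbox 0 (\<chi> i. 2 * pi)) willmore_density = 0"
  shows "umbilicity_defect w = 0"
proof -
  obtain w' where w': "w' \<in> cbox 0 (\<chi> i. 2 * pi)" "umbilicity_defect w' = umbilicity_defect w"
    using periodic_reduce[of umbilicity_defect w] periodic_umbilicity_defect by blast
  have "(willmore_density has_integral 0) (cbox 0 (\<chi> i. 2 * pi))"
    using integrable_integral[OF integrable_continuous[OF continuous_willmore_density]] assms by metis
  moreover have "box 0 (\<chi> i. 2 * pi) \<noteq> ({} :: (real ^ 2) set)"
    by (simp add: interval_ne_empty_cart)
  ultimately have "willmore_density w' = 0"
    using has_integral_0_cbox_imp_0[OF continuous_willmore_density willmore_density_nonneg _ _ w'(1)]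
    by blast
  then show ?thesis
    using w'(2) det_g_pos[of w'] g11_pos[of w'] by (simp add: willmore_density_defect)
qed

end

section \<open>The image of a totally geodesic torus\<close>

context S2xS1_torus
begin

text \<open>
  Flatness makes the derivatives of the first component \<open>p\<close> of \<open>X\<close> linearly dependent, so some unit vector \<open>b\<close> is
  orthogonal at the origin to \<open>p\<close> and to both derivatives of \<open>p\<close>. Since the second fundamental form
  is zero, the inner products of \<open>b\<close> with \<open>p\<close> and with its derivatives satisfy
  a homogeneous linear system of differential equations along coordinate lines and remain zero.
  Going first along one axis and then along the other reaches every point of the plane.
\<close>

lemma totally_geodesic_in_great_circle:
  assumes tg: "\<And>i j w. II i j w = 0" and flat: "\<And>w. ambient_curvature X w = 0"
  obtains b where "norm b = 1" "\<And>w. fst (X w) \<bullet> b = 0"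
proof -
  have num: "ambient_curvature_numerator w = 0" for w
    using flat[of w] det_g_pos[of w] by (simp add: ambient_curvature_eq)
  obtain b where b: "norm b = 1" "fst (X 0) \<bullet> b = 0" "fst (dX 1 0) \<bullet> b = 0" "fst (dX 2 0) \<bullet> b = 0"
  proof -
    have "(fst (dX 1 0) \<bullet> fst (dX 1 0)) * (fst (dX 2 0) \<bullet> fst (dX 2 0)) - (fst (dX 1 0) \<bullet> fst (dX 2 0))\<^sup>2 = 0"
      using num[of 0] Cauchy_Schwarz_ineq[of "fst (dX 1 0)" "fst (dX 2 0)"]
        Cauchy_Schwarz_ineq[of "snd (dX 1 0)" "snd (dX 2 0)"]
      unfolding ambient_curvature_numerator_def by linarith
    then obtain a c where ac: "a \<noteq> 0 \<or> c \<noteq> 0" "a *\<^sub>R fst (dX 1 0) + c *\<^sub>R fst (dX 2 0) = 0"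
      by (rule gram_zero_imp_dependent)
    have 0: "a * (fst (dX 1 0) \<bullet> b) + c * (fst (dX 2 0) \<bullet> b) = 0" for b
      using arg_cong[OF ac(2), of "\<lambda>v. v \<bullet> b"] by (simp add: inner_add_left)
    show ?thesis
    proof (cases "a = 0")
      case True
      obtain b where "norm b = 1" "fst (X 0) \<bullet> b = 0" "fst (dX 1 0) \<bullet> b = 0"
        by (rule exists_orthogonal_to_two)
      then show ?thesis using 0[of b] ac(1) True by (intro that[of b]) auto
    next
      case False
      obtain b where "norm b = 1" "fst (X 0) \<bullet> b = 0" "fst (dX 2 0) \<bullet> b = 0"
        by (rule exists_orthogonal_to_two)
      then show ?thesis using 0[of b] False by (intro that[of b]) auto
    qed
  qed
  define f where "f = (\<lambda>w. fst (X w) \<bullet> b)"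
  define f' where "f' = (\<lambda>i w. fst (dX i w) \<bullet> b)"
  \<comment> \<open>The system for \<open>f\<close> and its two derivatives is controlled by the sum of their squares.\<close>
  define e where "e = (\<lambda>w. (f w)\<^sup>2 + ((f' 1 w)\<^sup>2 + (f' 2 w)\<^sup>2))"
  have ddX: "fst (ddX i j w) \<bullet> b = \<Gamma> 1 i j w * f' 1 w + \<Gamma> 2 i j w * f' 2 w
      - (fst (dX i w) \<bullet> fst (dX j w)) * f w" for i j w
  proof -
    have "fst (II i j w) \<bullet> b = 0" by (simp add: tg)
    then show ?thesis
      by (simp add: second_fund_form_eq inner_diff_left inner_add_left f_def f'_def)
  qed
  have df: "((\<lambda>t. f (a + t *\<^sub>R axis i 1)) has_real_derivative f' i (a + t *\<^sub>R axis i 1)) (at t)" for a i t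
    using DERIV_along_line[of f a t "axis i 1"]
    by (simp add: f_def f'_def differentiable_inner_const differentiable_fst differentiable_X
        dir_deriv_inner partial_fst dir_deriv_const)
  have df': "((\<lambda>t. f' j (a + t *\<^sub>R axis i 1)) has_real_derivative fst (ddX i j (a + t *\<^sub>R axis i 1)) \<bullet> b) (at t)" for a i j t
    using DERIV_along_line[of "f' j" a t "axis i 1"]
    by (simp add: f'_def differentiable_inner_const differentiable_fst differentiable_dX
        dir_deriv_inner partial_fst dir_deriv_const)
  \<comment> \<open>Every product of two of the three functions is at most \<open>e\<close>, so the coefficients of the system
    bound the logarithmic derivative of \<open>e\<close>.\<close>
  define m where "m = (\<lambda>i w. 2 * (1 + (\<bar>\<Gamma> 1 i 1 w\<bar> + \<bar>\<Gamma> 2 i 1 w\<bar> + \<bar>fst (dX i w) \<bullet> fst (dX 1 w)\<bar>)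
      + (\<bar>\<Gamma> 1 i 2 w\<bar> + \<bar>\<Gamma> 2 i 2 w\<bar> + \<bar>fst (dX i w) \<bullet> fst (dX 2 w)\<bar>)))"
  have step: "e (a + t *\<^sub>R axis i 1) = 0" if "e a = 0" for a t i
  proof (rule gronwall_zero[where \<phi> = "\<lambda>t. e (a + t *\<^sub>R axis i 1)" and M = "\<lambda>t. m i (a + t *\<^sub>R axis i 1)"
        and \<phi>' = "\<lambda>t. let w = a + t *\<^sub>R axis i 1 in 2 * (f w * f' i w
          + f' 1 w * (fst (ddX i 1 w) \<bullet> b) + f' 2 w * (fst (ddX i 2 w) \<bullet> b))"])
    fix t
    let ?w = "a + t *\<^sub>R axis i 1"
    show "((\<lambda>t. e (a + t *\<^sub>R axis i 1)) has_real_derivative (let w = ?w in 2 * (f w * f' i w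
          + f' 1 w * (fst (ddX i 1 w) \<bullet> b) + f' 2 w * (fst (ddX i 2 w) \<bullet> b)))) (at t)"
      unfolding e_def Let_def by (auto intro!: derivative_eq_intros df df' simp: algebra_simps)
    show "e ?w \<ge> 0" by (simp add: e_def)
    have sq: "0 \<le> (f ?w)\<^sup>2" "0 \<le> (f' 1 ?w)\<^sup>2" "0 \<le> (f' 2 ?w)\<^sup>2" by auto
    have e1: "\<bar>x * y\<bar> \<le> e ?w" if "x \<in> {f ?w, f' 1 ?w, f' 2 ?w}" "y \<in> {f ?w, f' 1 ?w, f' 2 ?w}" for x y
    proof -
      have "\<bar>z\<bar> \<le> sqrt (e ?w)" if "z \<in> {f ?w, f' 1 ?w, f' 2 ?w}" for z
        using that sq by (intro real_le_rsqrt) (auto simp: e_def)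
      from mult_mono[OF this[OF that(1)] this[OF that(2)]] show ?thesis
        using \<open>e ?w \<ge> 0\<close> by (simp add: abs_mult)
    qed
    have e2: "\<bar>c * (x * y)\<bar> \<le> \<bar>c\<bar> * e ?w" if "x \<in> {f ?w, f' 1 ?w, f' 2 ?w}" "y \<in> {f ?w, f' 1 ?w, f' 2 ?w}" for x y c
      using mult_left_mono[OF e1[OF that], of "\<bar>c\<bar>"] by (simp add: abs_mult)
    have fi: "\<bar>f ?w * f' i ?w\<bar> \<le> e ?w" using e1 exhaust_2[of i] by auto
    have fj: "\<bar>f' j ?w * (fst (ddX i j ?w) \<bullet> b)\<bar>
        \<le> (\<bar>\<Gamma> 1 i j ?w\<bar> + \<bar>\<Gamma> 2 i j ?w\<bar> + \<bar>fst (dX i ?w) \<bullet> fst (dX j ?w)\<bar>) * e ?w" for j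
    proof -
      have j: "f' j ?w \<in> {f ?w, f' 1 ?w, f' 2 ?w}" using exhaust_2[of j] by auto
      have "f' j ?w * (fst (ddX i j ?w) \<bullet> b) = \<Gamma> 1 i j ?w * (f' j ?w * f' 1 ?w)
          + \<Gamma> 2 i j ?w * (f' j ?w * f' 2 ?w) - (fst (dX i ?w) \<bullet> fst (dX j ?w)) * (f' j ?w * f ?w)"
        unfolding ddX by (simp add: algebra_simps)
      moreover have "\<bar>\<Gamma> 1 i j ?w * (f' j ?w * f' 1 ?w)\<bar> \<le> \<bar>\<Gamma> 1 i j ?w\<bar> * e ?w"
        "\<bar>\<Gamma> 2 i j ?w * (f' j ?w * f' 2 ?w)\<bar> \<le> \<bar>\<Gamma> 2 i j ?w\<bar> * e ?w"
        "\<bar>(fst (dX i ?w) \<bullet> fst (dX j ?w)) * (f' j ?w * f ?w)\<bar> \<le> \<bar>fst (dX i ?w) \<bullet> fst (dX j ?w)\<bar> * e ?w"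
        by (rule e2[OF j]; simp)+
      ultimately show ?thesis unfolding distrib_right by linarith
    qed
    show "\<bar>let w = ?w in 2 * (f w * f' i w
          + f' 1 w * (fst (ddX i 1 w) \<bullet> b) + f' 2 w * (fst (ddX i 2 w) \<bullet> b))\<bar> \<le> m i ?w * e ?w"
    proof -
      have "\<bar>2 * (x + y + z)\<bar> \<le> 2 * (x' + y' + z')" if "\<bar>x\<bar> \<le> x'" "\<bar>y\<bar> \<le> y'" "\<bar>z\<bar> \<le> z'"
        for x y z x' y' z' :: real using that unfolding abs_le_iff by auto
      from this[OF fi fj[of 1] fj[of 2]] show ?thesis
        unfolding m_def Let_def distrib_right mult.assoc by simp
    qed
  next
    have m: "continuous_on UNIV (m i)"
      unfolding m_def by (intro continuous_intros)
    show "continuous_on UNIV (\<lambda>t. m i (a + t *\<^sub>R axis i 1))"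
      by (rule continuous_on_compose2[OF m]) (auto intro!: continuous_intros)
    show "e (a + 0 *\<^sub>R axis i 1) = 0" using that by simp
  qed
  have "e 0 = 0" using b by (simp add: e_def f_def f'_def)
  have "e w = 0" for w
  proof -
    have "e ((0 + w $ 1 *\<^sub>R axis 1 1) + w $ 2 *\<^sub>R axis 2 1) = 0"
      by (intro step \<open>e 0 = 0\<close>)
    moreover have "(0 + w $ 1 *\<^sub>R axis 1 1) + w $ 2 *\<^sub>R axis 2 1 = w"
      by (simp add: vec_eq_iff forall_2 axis_def)
    ultimately show ?thesis by metis
  qed
  then have "f w = 0" for w
    by (simp add: e_def add_nonneg_eq_0_iff)
  with b(1) show ?thesis by (intro that[of b]) (auto simp: f_def)
qed

text \<open>
  To show that a given \<open>y\<close> is attained, take \<open>w0\<close> where \<open>X w \<bullet> y\<close> is maximal. Criticality leaves only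
  the four points with components \<open>\<plusminus> fst y\<close> and \<open>\<plusminus> snd y\<close>. There are directions in which only one
  component of \<open>X\<close> moves to first order; the second derivative in these directions has the
  sign opposite to that of the corresponding inner product, which excludes the minus signs.
\<close>

lemma totally_geodesic_range:
  assumes tg: "\<And>i j w. II i j w = 0" and flat: "\<And>w. ambient_curvature X w = 0"
    and b: "norm b = 1" "\<And>w. fst (X w) \<bullet> b = 0"
  shows "range X = {y \<in> S2xS1. fst y \<bullet> b = 0}"
proof (intro equalityI subsetI)
  fix y assume "y \<in> range X" then show "y \<in> {y \<in> S2xS1. fst y \<bullet> b = 0}"
    using in_S2xS1 b(2) by auto
next
  fix y assume "y \<in> {y \<in> S2xS1. fst y \<bullet> b = 0}"
  then have y: "fst y \<bullet> fst y = 1" "snd y \<bullet> snd y = 1" "fst y \<bullet> b = 0"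
    by (auto simp: S2xS1_def dot_square_norm)
  have ne: "cbox 0 (\<chi> i. 2 * pi) \<noteq> ({} :: (real ^ 2) set)"
    by (simp add: interval_ne_empty_cart)
  have "continuous_on (cbox 0 (\<chi> i. 2 * pi)) (\<lambda>w. X w \<bullet> y)"
    by (intro continuous_intros)
  from continuous_attains_sup[OF compact_cbox ne this]
  obtain w0 where w0: "\<And>w. w \<in> cbox 0 (\<chi> i. 2 * pi) \<Longrightarrow> X w \<bullet> y \<le> X w0 \<bullet> y"
    by blast
  have max: "X w \<bullet> y \<le> X w0 \<bullet> y" for w
  proof -
    obtain w' where "w' \<in> cbox 0 (\<chi> i. 2 * pi)" "X w' = X w"
      using periodic_reduce[of X w] periodic by blast
    with w0[of w'] show ?thesis by simp
  qed
  let ?c = "\<lambda>h t. dir_deriv h X (w0 + t *\<^sub>R h) \<bullet> y"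
  have d1: "((\<lambda>t. X (w0 + t *\<^sub>R h) \<bullet> y) has_real_derivative ?c h t) (at t)" for h t
    using DERIV_along_line[of "\<lambda>w. X w \<bullet> y" w0 t h]
    by (simp add: differentiable_inner_const differentiable_X dir_deriv_inner dir_deriv_const)
  have crit: "dir_deriv h X w0 \<bullet> y = 0" for h
  proof -
    have "?c h 0 = 0"
      by (rule DERIV_local_max[OF d1, of 1]) (use max in auto)
    then show ?thesis by simp
  qed
  have dh: "dir_deriv h X = (\<lambda>z. h $ 1 *\<^sub>R dX 1 z + h $ 2 *\<^sub>R dX 2 z)" for h
    by (rule ext) (rule dir_deriv_expand[OF differentiable_X])
  have diff_dh: "dir_deriv h X differentiable at z" for h z
    unfolding dh[of h] by (intro differentiable_add differentiable_scaleR differentiable_const differentiable_dX)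
  have ddX: "ddX i j w0 \<bullet> y = - (fst (dX i w0) \<bullet> fst (dX j w0)) * (fst (X w0) \<bullet> fst y)
      - (snd (dX i w0) \<bullet> snd (dX j w0)) * (snd (X w0) \<bullet> snd y)" for i j
  proof -
    have "dX k w0 \<bullet> y = 0" for k by (rule crit)
    moreover have "II i j w0 \<bullet> y = 0" by (simp add: tg)
    ultimately show ?thesis
      by (simp add: second_fund_form_eq inner_diff_left inner_add_left inner_prod_def[of "(_, _)"])
  qed
  have second: "(let v = dir_deriv h X w0 in
      - (fst v \<bullet> fst v) * (fst (X w0) \<bullet> fst y) - (snd v \<bullet> snd v) * (snd (X w0) \<bullet> snd y)) \<le> 0" for h
  proof -
    have "((\<lambda>t. ?c h t) has_real_derivative dir_deriv h (dir_deriv h X) (w0 + 0 *\<^sub>R h) \<bullet> y) (at 0)"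
      using DERIV_along_line[of "\<lambda>w. dir_deriv h X w \<bullet> y" w0 0 h]
      by (simp add: differentiable_inner_const diff_dh dir_deriv_inner dir_deriv_const)
    from second_derivative_at_max[OF d1 this] have "dir_deriv h (dir_deriv h X) w0 \<bullet> y \<le> 0"
      using max crit by simp
    moreover have "dir_deriv h (dir_deriv h X) w0 = h $ 1 *\<^sub>R dir_deriv h (dX 1) w0 + h $ 2 *\<^sub>R dir_deriv h (dX 2) w0"
      unfolding dh[of h]
      by (rule dir_deriv_eqI)
         (intro has_derivative_add has_derivative_scaleR_right has_derivative_dir_deriv differentiable_dX)
    ultimately show ?thesis
      by (simp add: dir_deriv_expand[where h = h, OF differentiable_dX] dir_deriv_expand[where h = h, OF differentiable_X]
          inner_add_left inner_add_right ddX Let_def algebra_simps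
          inner_commute[of "fst (dX 2 w0)" "fst (dX 1 w0)"] inner_commute[of "snd (dX 2 w0)" "snd (dX 1 w0)"])
  qed
  have num: "ambient_curvature_numerator w0 = 0"
    using flat[of w0] det_g_pos[of w0] by (simp add: ambient_curvature_eq)
  have gram: "(fst (dX 1 w0) \<bullet> fst (dX 1 w0)) * (fst (dX 2 w0) \<bullet> fst (dX 2 w0)) - (fst (dX 1 w0) \<bullet> fst (dX 2 w0))\<^sup>2 = 0"
    "(snd (dX 1 w0) \<bullet> snd (dX 1 w0)) * (snd (dX 2 w0) \<bullet> snd (dX 2 w0)) - (snd (dX 1 w0) \<bullet> snd (dX 2 w0))\<^sup>2 = 0"
    using num Cauchy_Schwarz_ineq[of "fst (dX 1 w0)" "fst (dX 2 w0)"]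
      Cauchy_Schwarz_ineq[of "snd (dX 1 w0)" "snd (dX 2 w0)"]
    unfolding ambient_curvature_numerator_def by linarith+
  have dXb: "fst (dX i w0) \<bullet> b = 0" for i
  proof -
    have "partial_deriv i (\<lambda>w. fst (X w) \<bullet> b) w0 = 0"
      unfolding b(2) by (rule dir_deriv_const)
    then show ?thesis
      by (simp add: dir_deriv_inner differentiable_fst differentiable_X partial_fst dir_deriv_const)
  qed
  have tangent: "dir_deriv (vector [a, c]) X w0 = a *\<^sub>R dX 1 w0 + c *\<^sub>R dX 2 w0" for a c
    using dir_deriv_expand[OF differentiable_X, where h = "vector [a, c]"] by simp
  have immersed: "dir_deriv (vector [a, c]) X w0 \<noteq> 0" if "a \<noteq> 0 \<or> c \<noteq> 0" for a c
    using that dX_independent[of a w0 c] by (auto simp: tangent)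
  \<comment> \<open>The vector \<open>v\<close> moves the first component of \<open>X\<close> only; in the next step the factors are exchanged.\<close>
  have 1: "fst y = fst (X w0)"
  proof -
    obtain a c where ac: "a \<noteq> 0 \<or> c \<noteq> 0" "a *\<^sub>R snd (dX 1 w0) + c *\<^sub>R snd (dX 2 w0) = 0"
      using gram(2) by (rule gram_zero_imp_dependent)
    define v where "v = dir_deriv (vector [a, c]) X w0"
    have v: "snd v = 0" "v \<noteq> 0" using ac immersed[of a c] by (simp_all add: v_def tangent)
    then have v1: "fst v \<noteq> 0" by (simp add: prod_eq_iff)
    have "v \<bullet> y = 0" unfolding v_def by (rule crit)
    then have vy: "fst v \<bullet> fst y = 0" using v by (simp add: inner_prod_def)
    have eq: "fst y = (fst y \<bullet> fst (X w0)) *\<^sub>R fst (X w0)"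
      by (rule collinear_if_orthogonal_frame_3[OF X_on_spheres(1) v1 _ _ _ _ vy, of b])
         (use b y in \<open>auto simp: v_def tangent inner_add_left dX_tangent dXb inner_commute[of b]\<close>)
    have "(fst v \<bullet> fst v) * (fst (X w0) \<bullet> fst y) \<ge> 0"
      using second[of "vector [a, c]"] v by (simp add: v_def[symmetric] Let_def)
    then have nn: "fst y \<bullet> fst (X w0) \<ge> 0"
      using mult_le_cancel_left_pos[of "fst v \<bullet> fst v" 0] v1 by (simp add: inner_commute)
    show ?thesis
      by (rule unit_multiple_nonneg[OF y(1) X_on_spheres(1) eq nn])
  qed
  have 2: "snd y = snd (X w0)"
  proof -
    obtain a c where ac: "a \<noteq> 0 \<or> c \<noteq> 0" "a *\<^sub>R fst (dX 1 w0) + c *\<^sub>R fst (dX 2 w0) = 0"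
      using gram(1) by (rule gram_zero_imp_dependent)
    define v where "v = dir_deriv (vector [a, c]) X w0"
    have v: "fst v = 0" "v \<noteq> 0" using ac immersed[of a c] by (simp_all add: v_def tangent)
    then have v1: "snd v \<noteq> 0" by (simp add: prod_eq_iff)
    have "v \<bullet> y = 0" unfolding v_def by (rule crit)
    then have vy: "snd v \<bullet> snd y = 0" using v by (simp add: inner_prod_def)
    have eq: "snd y = (snd y \<bullet> snd (X w0)) *\<^sub>R snd (X w0)"
      by (rule collinear_if_orthogonal_frame_2[OF X_on_spheres(2) v1 _ vy])
         (auto simp: v_def tangent inner_add_left dX_tangent)
    have "(snd v \<bullet> snd v) * (snd (X w0) \<bullet> snd y) \<ge> 0"
      using second[of "vector [a, c]"] v by (simp add: v_def[symmetric] Let_def)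
    then have nn: "snd y \<bullet> snd (X w0) \<ge> 0"
      using mult_le_cancel_left_pos[of "snd v \<bullet> snd v" 0] v1 by (simp add: inner_commute)
    show ?thesis
      by (rule unit_multiple_nonneg[OF y(2) X_on_spheres(2) eq nn])
  qed
  from 1 2 have "y = X w0" by (simp add: prod_eq_iff)
  then show "y \<in> range X" by simp
qed

end

section \<open>The Clifford torus\<close>

lemma norm_real2_circle:
  fixes v :: "real ^ 2"
  assumes "norm v = 1"
  obtains u where "v = vector [cos u, sin u]"
proof -
  have "v \<bullet> v = 1" using assms by (simp add: dot_square_norm)
  then have "(v $ 1)\<^sup>2 + (v $ 2)\<^sup>2 = 1" by (simp add: inner_vec_def sum_2 power2_eq_square)
  then obtain u where "v $ 1 = cos u" "v $ 2 = sin u" by (rule sincos_total_2pi)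
  then show ?thesis by (intro that[of u]) (simp add: vec_eq_iff forall_2)
qed

lemma norm_cos_sin: "norm (vector [cos u, sin u] :: real ^ 2) = 1"
  by (simp add: norm_eq_sqrt_inner inner_vec_def sum_2 power2_eq_square[symmetric])

lemma range_torus_cover: "range torus_cover = T2"
proof (intro equalityI subsetI)
  fix z assume "z \<in> range torus_cover"
  then show "z \<in> T2" by (auto simp: torus_cover_def T2_def norm_cos_sin)
next
  fix z assume "z \<in> T2"
  then have "norm (fst z) = 1" "norm (snd z) = 1" by (auto simp: T2_def)
  then obtain u v where "fst z = vector [cos u, sin u]" "snd z = vector [cos v, sin v]"
    using norm_real2_circle by metis
  then have "z = torus_cover (vector [u, v])"
    by (simp add: torus_cover_def prod_eq_iff)
  then show "z \<in> range torus_cover" by simp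
qed

lemma clifford_torus_eq: "clifford_torus = {y \<in> S2xS1. fst y \<bullet> axis 3 1 = 0}"
proof (intro equalityI subsetI)
  fix y assume "y \<in> clifford_torus"
  then obtain u v where y: "y = (vector [cos u, sin u, 0], vector [cos v, sin v])"
    by (auto simp: clifford_torus_def)
  have "norm (vector [cos u, sin u, 0] :: real ^ 3) = 1"
    by (simp add: norm_eq_sqrt_inner inner_vec_def sum_3 power2_eq_square[symmetric])
  then show "y \<in> {y \<in> S2xS1. fst y \<bullet> axis 3 1 = 0}"
    by (simp add: y S2xS1_def norm_cos_sin inner_axis)
next
  fix y assume "y \<in> {y \<in> S2xS1. fst y \<bullet> axis 3 1 = 0}"
  then have y: "norm (fst y) = 1" "norm (snd y) = 1" "fst y $ 3 = 0"
    by (auto simp: S2xS1_def inner_axis)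
  have "fst y \<bullet> fst y = 1" using y(1) by (simp add: dot_square_norm)
  then have "(fst y $ 1)\<^sup>2 + (fst y $ 2)\<^sup>2 = 1"
    using y(3) by (simp add: inner_vec_def sum_3 power2_eq_square)
  then obtain u where "fst y $ 1 = cos u" "fst y $ 2 = sin u" by (rule sincos_total_2pi)
  then have "fst y = vector [cos u, sin u, 0]" using y(3) by (simp add: vec_eq_iff forall_3)
  moreover obtain v where "snd y = vector [cos v, sin v]"
    using y(2) by (rule norm_real2_circle)
  ultimately have "y = (vector [cos u, sin u, 0], vector [cos v, sin v])" by (simp add: prod_eq_iff)
  then show "y \<in> clifford_torus" unfolding clifford_torus_def by blast
qed

text \<open>
  An orthogonal map of \<open>\<real>\<^sup>3\<close> taking \<open>b\<close> to the third axis, extended by the identity of \<open>\<real>\<^sup>2\<close>.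
\<close>

lemma great_circle_torus_congruent:
  fixes b :: "real ^ 3"
  assumes b: "norm b = 1"
  shows "\<exists>\<phi>. isometry_S2xS1 \<phi> \<and> \<phi> ` {y \<in> S2xS1. fst y \<bullet> b = 0} = clifford_torus"
proof -
  have "norm b = norm (axis 3 1 :: real ^ 3)" using b by simp
  then obtain R where R: "orthogonal_transformation R" "R b = (axis 3 1 :: real ^ 3)"
    by (rule orthogonal_transformation_exists)
  define \<phi> :: "ambient \<Rightarrow> ambient" where "\<phi> = (\<lambda>y. (R (fst y), snd y))"
  have lin: "bounded_linear R" using R(1) by (simp add: orthogonal_transformation_linear linear_conv_bounded_linear[symmetric])
  have inner: "R u \<bullet> R v = u \<bullet> v" for u v using R(1) by (simp add: orthogonal_transformation_def)
  have nR: "norm (R u) = norm u" for u using R(1) by (rule orthogonal_transformation_norm)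
  have bl: "bounded_linear \<phi>"
    unfolding \<phi>_def
    by (intro bounded_linear_Pair bounded_linear_compose[OF lin] bounded_linear_fst bounded_linear_snd)
  have deriv: "frechet_derivative \<phi> (at y) = \<phi>" for y
    using frechet_derivative_at[OF bounded_linear_imp_has_derivative[OF bl], of y] by simp
  have inj: "inj \<phi>"
    using orthogonal_transformation_inj[OF R(1)] by (auto simp: \<phi>_def inj_def prod_eq_iff)
  have img: "\<phi> ` {y \<in> S2xS1. P (fst y \<bullet> b)} = {y \<in> S2xS1. P (fst y \<bullet> axis 3 1)}" for P
  proof (intro equalityI subsetI)
    fix z assume "z \<in> \<phi> ` {y \<in> S2xS1. P (fst y \<bullet> b)}"
    then show "z \<in> {y \<in> S2xS1. P (fst y \<bullet> axis 3 1)}"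
      using R(2) inner by (auto simp: \<phi>_def S2xS1_def nR) (metis inner)
  next
    fix z assume z: "z \<in> {y \<in> S2xS1. P (fst y \<bullet> axis 3 1)}"
    obtain u where u: "fst z = R u" using orthogonal_transformation_surj[OF R(1)] by (metis surjD)
    have "fst z \<bullet> axis 3 1 = u \<bullet> b" using u R(2) inner by metis
    then have "(u, snd z) \<in> {y \<in> S2xS1. P (fst y \<bullet> b)}"
      using z u nR[of u] by (auto simp: S2xS1_def)
    moreover have "z = \<phi> (u, snd z)" using u by (simp add: \<phi>_def prod_eq_iff)
    ultimately show "z \<in> \<phi> ` {y \<in> S2xS1. P (fst y \<bullet> b)}" by blast
  qed
  have "isometry_S2xS1 \<phi>"
    unfolding isometry_S2xS1_def
  proof (intro conjI ballI)
    show "\<exists>U. S2xS1 \<subseteq> U \<and> smooth_on U \<phi>"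
      using smooth_on_bounded_linear[OF bl] by blast
    show "bij_betw \<phi> S2xS1 S2xS1"
      using inj img[of "\<lambda>_. True"] by (auto simp: bij_betw_def intro: inj_on_subset)
    show "frechet_derivative \<phi> (at y) v \<bullet> frechet_derivative \<phi> (at y) w = v \<bullet> w" for y v w
      unfolding deriv by (simp add: \<phi>_def inner_prod_def inner)
  qed
  with img[of "\<lambda>r. r = 0"] show ?thesis unfolding clifford_torus_eq by blast
qed

lemma immersed_torus_surface:
  assumes "immersed_torus x"
  shows "S2xS1_torus (x \<circ> torus_cover)"
proof unfold_locales
  show "smooth_on UNIV (x \<circ> torus_cover)" "inj (frechet_derivative (x \<circ> torus_cover) (at w))" for w
    using assms by (auto simp: immersed_torus_def)
  show "(x \<circ> torus_cover) w \<in> S2xS1" for w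
    using assms range_torus_cover by (auto simp: immersed_torus_def)
  show "(x \<circ> torus_cover) (w + (2 * pi) *\<^sub>R axis k 1) = (x \<circ> torus_cover) w" for w k
    using exhaust_2[of k] by (auto simp: torus_cover_def axis_def)
qed

section \<open>Nonnegativity and the case of equality\<close>

theorem proposition4p1:
  fixes x :: "(real ^ 2) \<times> (real ^ 2) \<Rightarrow> (real ^ 3) \<times> (real ^ 2)"
  assumes "immersed_torus x"
  shows "willmore x \<ge> 0 \<and>
         (willmore x = 0 \<longleftrightarrow> totally_geodesic x) \<and>
         (totally_geodesic x \<longrightarrow>
            (\<exists>\<phi>. isometry_S2xS1 \<phi> \<and> \<phi> ` (x ` T2) = clifford_torus))"
proof -
  interpret S2xS1_torus "x \<circ> torus_cover"
    by (rule immersed_torus_surface[OF assms])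
  have W: "willmore x = integral (cbox 0 (\<chi> i. 2 * pi)) willmore_density"
    by (simp add: willmore_def Let_def willmore_density_def[abs_def])
  have nn: "willmore x \<ge> 0"
    unfolding W
    by (intro integral_nonneg integrable_continuous continuous_willmore_density willmore_density_nonneg)
  have geodesic: "totally_geodesic x" if "willmore x = 0"
    unfolding totally_geodesic_def
    using umbilic_torus(1)[OF willmore_zero_imp_umbilic] that W by auto
  have zero: "willmore x = 0" and congruent: "\<exists>\<phi>. isometry_S2xS1 \<phi> \<and> \<phi> ` (x ` T2) = clifford_torus"
    if "totally_geodesic x"
  proof -
    have tg: "second_fund_form (x \<circ> torus_cover) i j w = 0" for i j w
      using that by (simp add: totally_geodesic_def)
    have defect: "umbilicity_defect w = 0" for w by (rule totally_geodesic_defect[OF tg])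
    then show "willmore x = 0" unfolding W by (simp add: willmore_density_defect[abs_def])
    have flat: "ambient_curvature (x \<circ> torus_cover) w = 0" for w
      by (rule umbilic_torus(2)[OF defect])
    obtain b where b: "norm b = 1" "\<And>w. fst ((x \<circ> torus_cover) w) \<bullet> b = 0"
      using totally_geodesic_in_great_circle[OF tg flat] by blast
    have "x ` T2 = {y \<in> S2xS1. fst y \<bullet> b = 0}"
      using totally_geodesic_range[OF tg flat b] by (simp only: image_comp[symmetric] range_torus_cover)
    with great_circle_torus_congruent[OF b(1)]
    show "\<exists>\<phi>. isometry_S2xS1 \<phi> \<and> \<phi> ` (x ` T2) = clifford_torus" by simp
  qed
  from nn geodesic zero congruent show ?thesis by blast
qed

end
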